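(* Let $T>0$, let $M=(M_t)_{t\in[0,T]}\neq 0$ be a continuous and square integrable martingale vanishing at $0$ for which there exists $\mu\in C^0((0,T];\mathbb R_+)$ such that $\mu(\cdot)^{-1}$ is continuous from $[0,T]$ into $\mathbb R_+$ and $\langle M\rangle_t=\int_0^t\mu(s)\,ds$ for every $t\in[0,T]$. Let $J_0$ be an unknown function which almost surely belongs to $\mathbb L^2([0,T],d\langle M\rangle_t)$. Let $N\in\mathbb N^*$, let $\varphi_1,\dots,\varphi_N$ be continuous functions from $[0,T]$ into $\mathbb R$ such that $(\varphi_1,\dots,\varphi_N)$ is an orthonormal family in $\mathbb L^2([0,T],dt)$, and let $\mathcal S_m={\rm span}\{\varphi_1,\dots,\varphi_m\}$ for $m\in\{1,\dots,N\}$. Then there exists a deterministic constant $\mathfrak c>0$, not depending on $m$, $N$ and $n$, such that the discrete-time estimator $\widehat J_{m,N,n}$ (defined in the context) satisfies $$\mathbb E[\|\widehat J_{m,N,n}-J_0\|_{\langle M\rangle}^{2}]\leqslant2\min_{J\in\mathcal S_m}\|J-J_0\|_{\langle M\rangle}^{2}+\mathfrak c\left(\frac mN+\frac{mR(m)}{n^2}\right),$$ where $$R(m)=\sup_{t\in[0,T]}\sum_{j=1}^m\varphi_j'(t)^2.$$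
   Context: The process $Z$ is $Z_t=\int_0^tJ_0(s)\,d\langle M\rangle_s+M_t$, $t\in[0,T]$. $M^1,\dots,M^N$ (resp. $Z^1,\dots,Z^N$) are $N$ independent copies of $M$ (resp. $Z$), with $Z^i_t=\int_0^tJ_0(s)\,d\langle M\rangle_s+M^i_t$. Norm: $\|\varphi\|_{\langle M\rangle}^2=\int_0^T\varphi(s)^2\,d\langle M\rangle_s$. In $R(m)$, $\varphi_j'$ is the derivative of $\varphi_j$. Discrete-time estimator: with $t_l=lT/n$, $l\in\{0,\dots,n\}$, $$\widehat J_{m,N,n}=\sum_{j=1}^m[\widehat\theta_{m,N,n}]_j\varphi_j,\qquad\widehat\theta_{m,N,n}=\Psi_m^{-1}z_{m,N,n},$$ where $\Psi_m=\left(\int_0^T\varphi_j(s)\varphi_k(s)\,d\langle M\rangle_s\right)_{j,k\in\{1,\dots,m\}}$ (a symmetric positive-definite matrix) and $$z_{m,N,n}=\left(\frac1N\sum_{i=1}^N\sum_{l=0}^{n-1}\varphi_j(t_l)(Z^i_{t_{l+1}}-Z^i_{t_l})\right)_{j\in\{1,\dots,m\}}.$$ *)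

theory Defs
  imports "HOL-Probability.Probability" "Jordan_Normal_Form.Gauss_Jordan_Elimination"
begin

(* A process on [0,T] is a function X :: real => 'a => real; its values outside [0,T] are ignored. *)

definition adapted_on ::
  "(real \<Rightarrow> 'a measure) \<Rightarrow> real \<Rightarrow> (real \<Rightarrow> 'a \<Rightarrow> real) \<Rightarrow> bool" where
  "adapted_on F T X \<longleftrightarrow> (\<forall>t\<in>{0..T}. X t \<in> borel_measurable (F t))"

definition martingale_on ::
  "'a measure \<Rightarrow> (real \<Rightarrow> 'a measure) \<Rightarrow> real \<Rightarrow> (real \<Rightarrow> 'a \<Rightarrow> real) \<Rightarrow> bool" where
  "martingale_on P F T X \<longleftrightarrow>
     adapted_on F T X \<and>
     (\<forall>t\<in>{0..T}. integrable P (X t)) \<and>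
     (\<forall>s\<in>{0..T}. \<forall>t\<in>{s..T}. AE \<omega> in P. real_cond_exp P (F s) (X t) \<omega> = X s \<omega>)"

definition continuous_paths_on ::
  "'a measure \<Rightarrow> real \<Rightarrow> (real \<Rightarrow> 'a \<Rightarrow> real) \<Rightarrow> bool" where
  "continuous_paths_on P T X \<longleftrightarrow> (AE \<omega> in P. continuous_on {0..T} (\<lambda>t. X t \<omega>))"

(* A is (a version of) the bracket <X>: the process, unique up to indistinguishability by
   Doob-Meyer, that is adapted, continuous, nondecreasing, null at 0 and such that
   X^2 - A is a martingale. *)
definition is_bracket ::
  "'a measure \<Rightarrow> (real \<Rightarrow> 'a measure) \<Rightarrow> real \<Rightarrow> (real \<Rightarrow> 'a \<Rightarrow> real) \<Rightarrow> (real \<Rightarrow> 'a \<Rightarrow> real) \<Rightarrow> bool" where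
  "is_bracket P F T X A \<longleftrightarrow>
     adapted_on F T A \<and>
     continuous_paths_on P T A \<and>
     (AE \<omega> in P. mono_on {0..T} (\<lambda>t. A t \<omega>)) \<and>
     (AE \<omega> in P. A 0 \<omega> = 0) \<and>
     martingale_on P F T (\<lambda>t \<omega>. (X t \<omega>)\<^sup>2 - A t \<omega>)"

definition path_on :: "real \<Rightarrow> (real \<Rightarrow> 'a \<Rightarrow> real) \<Rightarrow> 'a \<Rightarrow> (real \<Rightarrow> real)" where
  "path_on T X \<omega> = (\<lambda>t\<in>{0..T}. X t \<omega>)"

abbreviation path_space :: "real \<Rightarrow> (real \<Rightarrow> real) measure" where
  "path_space T \<equiv> Pi\<^sub>M {0..T} (\<lambda>_. borel)"

(* The processes Y 0, ..., Y (N-1) on Q are independent copies of the process X on P; Q may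
   differ from P, which need not be rich enough to carry copies of X. *)
definition independent_copies ::
  "'b measure \<Rightarrow> real \<Rightarrow> nat \<Rightarrow> (nat \<Rightarrow> real \<Rightarrow> 'b \<Rightarrow> real) \<Rightarrow> 'a measure \<Rightarrow> (real \<Rightarrow> 'a \<Rightarrow> real) \<Rightarrow> bool" where
  "independent_copies Q T N Y P X \<longleftrightarrow>
     prob_space.indep_vars Q (\<lambda>_. path_space T) (\<lambda>i. path_on T (Y i)) {..<N} \<and>
     (\<forall>i<N. distr Q (path_space T) (path_on T (Y i)) = distr P (path_space T) (path_on T X)) \<and>
     (\<forall>i<N. continuous_paths_on Q T (Y i))"

(* The Lebesgue-Stieltjes measure dV_t of a function V on [0,T], extended by constants. *)
definition stieltjes :: "real \<Rightarrow> (real \<Rightarrow> real) \<Rightarrow> real measure" where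
  "stieltjes T V = interval_measure (\<lambda>t. V (max 0 (min t T)))"

definition in_L2 :: "real \<Rightarrow> (real \<Rightarrow> real) \<Rightarrow> (real \<Rightarrow> real) \<Rightarrow> bool" where
  "in_L2 T V f \<longleftrightarrow>
     set_borel_measurable (stieltjes T V) {0..T} f \<and>
     set_integrable (stieltjes T V) {0..T} (\<lambda>s. (f s)\<^sup>2)"

definition bracket_sqnorm :: "real \<Rightarrow> (real \<Rightarrow> real) \<Rightarrow> (real \<Rightarrow> real) \<Rightarrow> real" where
  "bracket_sqnorm T V f = (LINT s:{0..T}|stieltjes T V. (f s)\<^sup>2)"

definition signal_process ::
  "real \<Rightarrow> (real \<Rightarrow> real) \<Rightarrow> (real \<Rightarrow> real) \<Rightarrow> (real \<Rightarrow> 'b \<Rightarrow> real) \<Rightarrow> real \<Rightarrow> 'b \<Rightarrow> real" where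
  "signal_process T V J0 X t \<omega> = (LINT s:{0..t}|stieltjes T V. J0 s) + X t \<omega>"

(* From here on, the families (phi_j), (Z^i) and all matrices are indexed from 0. *)

definition fun_span :: "nat \<Rightarrow> (nat \<Rightarrow> real \<Rightarrow> real) \<Rightarrow> (real \<Rightarrow> real) set" where
  "fun_span m \<phi> = {J. \<exists>a :: nat \<Rightarrow> real. J = (\<lambda>t. \<Sum>j<m. a j * \<phi> j t)}"

definition Psi_mat ::
  "real \<Rightarrow> (real \<Rightarrow> real) \<Rightarrow> (nat \<Rightarrow> real \<Rightarrow> real) \<Rightarrow> nat \<Rightarrow> real mat" where
  "Psi_mat T V \<phi> m =
     Matrix.mat m m (\<lambda>(j, k). LINT s:{0..T}|stieltjes T V. \<phi> j s * \<phi> k s)"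

definition z_vec ::
  "real \<Rightarrow> (nat \<Rightarrow> real \<Rightarrow> real) \<Rightarrow> (nat \<Rightarrow> real \<Rightarrow> 'b \<Rightarrow> real) \<Rightarrow> nat \<Rightarrow> nat \<Rightarrow> nat \<Rightarrow> 'b \<Rightarrow> real Matrix.vec" where
  "z_vec T \<phi> Z m N n \<omega> =
     Matrix.vec m (\<lambda>j. 1 / real N * (\<Sum>i<N. \<Sum>l<n.
       \<phi> j (real l * T / real n) *
       (Z i (real (Suc l) * T / real n) \<omega> - Z i (real l * T / real n) \<omega>)))"

definition theta_hat ::
  "real \<Rightarrow> (real \<Rightarrow> real) \<Rightarrow> (nat \<Rightarrow> real \<Rightarrow> real) \<Rightarrow> (nat \<Rightarrow> real \<Rightarrow> 'b \<Rightarrow> real) \<Rightarrow> nat \<Rightarrow> nat \<Rightarrow> nat \<Rightarrow> 'b \<Rightarrow> real Matrix.vec" where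
  "theta_hat T V \<phi> Z m N n \<omega> =
     the (mat_inverse (Psi_mat T V \<phi> m)) *\<^sub>v z_vec T \<phi> Z m N n \<omega>"

definition J_hat ::
  "real \<Rightarrow> (real \<Rightarrow> real) \<Rightarrow> (nat \<Rightarrow> real \<Rightarrow> real) \<Rightarrow> (nat \<Rightarrow> real \<Rightarrow> 'b \<Rightarrow> real) \<Rightarrow> nat \<Rightarrow> nat \<Rightarrow> nat \<Rightarrow> 'b \<Rightarrow> real \<Rightarrow> real" where
  "J_hat T V \<phi> Z m N n \<omega> t =
     (\<Sum>j<m. vec_index (theta_hat T V \<phi> Z m N n \<omega>) j * \<phi> j t)"

definition orthonormal_L2 :: "real \<Rightarrow> nat \<Rightarrow> (nat \<Rightarrow> real \<Rightarrow> real) \<Rightarrow> bool" where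
  "orthonormal_L2 T N \<phi> \<longleftrightarrow>
     (\<forall>j<N. \<forall>k<N. (LINT t:{0..T}|lborel. \<phi> j t * \<phi> k t) = (if j = k then 1 else 0))"

(* R(m), with value infinity if the derivatives are unbounded on [0,T]. *)
definition R_sup :: "real \<Rightarrow> (nat \<Rightarrow> real \<Rightarrow> real) \<Rightarrow> nat \<Rightarrow> ennreal" where
  "R_sup T \<phi>' m = (SUP t\<in>{0..T}. ennreal (\<Sum>j<m. (\<phi>' j t)\<^sup>2))"

end

theory Submission
  imports Defs "Jordan_Normal_Form.Determinant"
begin

text \<open>
  The estimator is a least-squares projection computed from noisy, discretised coefficients, and
  the bound is Pythagoras' theorem in \<open>L\<^sup>2(d\<langle>M\<rangle>)\<close> followed by one coefficient estimate.

  Write \<open>\<langle>f, g\<rangle>\<close> for the inner product of \<open>L\<^sup>2(d\<langle>M\<rangle>)\<close> and \<open>t\<^sub>l = l T / n\<close>. The normal equations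
  (\<open>L2_inner_J_hat\<close>) say that the estimator is the element of the span with
  \<open>\<langle>J_hat, \<psi>\<rangle> = 1/N \<Sum>\<^sub>i \<Sum>\<^sub>l \<psi>(t\<^sub>l) (Z\<^sup>i(t\<^sub>l\<^sub>+\<^sub>1) - Z\<^sup>i(t\<^sub>l))\<close> for every \<open>\<psi>\<close> in the span. Testing against a
  \<open>d\<langle>M\<rangle>\<close>-orthonormal basis \<open>\<psi>\<^sub>1, ..., \<psi>\<^sub>m\<close> of the span, instead of against the functions
  \<open>\<phi>\<^sub>1, ..., \<phi>\<^sub>m\<close> themselves, keeps the matrix \<open>\<Psi>\<^sub>m\<close> out of the estimates: pathwise, the squared
  error is the squared distance of \<open>J0\<close> from the span plus \<open>\<Sum>\<^sub>k (\<beta>\<^sub>k + Y\<^sub>k)\<^sup>2\<close>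
  (\<open>sqdist_eq_least_plus\<close>). Here \<open>\<beta>\<^sub>k\<close> is the error of the Riemann sum of \<open>\<psi>\<^sub>k\<close> against
  \<open>J0 d\<langle>M\<rangle>\<close>, and \<open>Y\<^sub>k\<close> is the average over the copies of the sum of \<open>\<psi>\<^sub>k(t\<^sub>l)\<close> times the increments
  of \<open>M\<close>.

  Both terms are controlled by the oscillation \<open>e\<close> of \<open>\<psi>\<^sub>k\<close> over a step of the grid. Since \<open>1/\<mu>\<close> is
  bounded, \<open>\<mu> \<ge> \<delta>\<close> for some \<open>\<delta> > 0\<close>; as the \<open>\<phi>\<^sub>j\<close> are orthonormal for \<open>dt\<close>, the coefficient vector
  of \<open>\<psi>\<^sub>k\<close> has squared length at most \<open>1/\<delta>\<close> (\<open>lincomb_sqnorm_ge\<close>), so the mean value theorem and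
  the Cauchy--Schwarz inequality give \<open>e\<^sup>2 \<le> \<eta> = T\<^sup>2 R(m) / (\<delta> n\<^sup>2)\<close> (\<open>lincomb_oscillation\<close>). Hence
  \<open>\<bar>\<beta>\<^sub>k\<bar> \<le> e \<integral>\<bar>J0\<bar> d\<langle>M\<rangle>\<close>. The increments of \<open>M\<close> are orthogonal with variances
  \<open>\<langle>M\<rangle>(t\<^sub>l\<^sub>+\<^sub>1) - \<langle>M\<rangle>(t\<^sub>l)\<close> and the copies are independent, so \<open>E[Y\<^sub>k\<^sup>2]\<close> is a Riemann sum of \<open>\<psi>\<^sub>k\<^sup>2\<close>
  divided by \<open>N\<close>, at most \<open>(2 + 2 \<eta> \<langle>M\<rangle>(T)) / N\<close>. Summing over \<open>k\<close> produces the orders \<open>m/N\<close> and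
  \<open>m R(m)/n\<^sup>2\<close>.
\<close>

section \<open>Square-integrable functions and orthonormal families\<close>

definition square_integrable :: "'a measure \<Rightarrow> ('a \<Rightarrow> real) \<Rightarrow> bool" where
  "square_integrable M f \<longleftrightarrow> f \<in> borel_measurable M \<and> integrable M (\<lambda>x. (f x)\<^sup>2)"

definition L2_inner :: "'a measure \<Rightarrow> ('a \<Rightarrow> real) \<Rightarrow> ('a \<Rightarrow> real) \<Rightarrow> real" where
  "L2_inner M f g = (\<integral>x. f x * g x \<partial>M)"

lemma L2_inner_commute: "L2_inner M f g = L2_inner M g f"
  by (simp add: L2_inner_def mult.commute)

lemma L2_inner_self: "L2_inner M f f = (\<integral>x. (f x)\<^sup>2 \<partial>M)"
  by (simp add: L2_inner_def power2_eq_square)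

lemma square_integrable_measurable [measurable_dest]:
  "square_integrable M f \<Longrightarrow> f \<in> borel_measurable M"
  by (simp add: square_integrable_def)

lemma integrable_mult_square_integrable:
  assumes f: "square_integrable M f" and g: "square_integrable M g"
  shows "integrable M (\<lambda>x. f x * g x)"
proof (rule Bochner_Integration.integrable_bound)
  show "integrable M (\<lambda>x. (f x)\<^sup>2 + (g x)\<^sup>2)"
    using f g by (auto simp: square_integrable_def)
  show "(\<lambda>x. f x * g x) \<in> borel_measurable M" using f g by measurable
  have "\<bar>a * b\<bar> \<le> a\<^sup>2 + b\<^sup>2" for a b :: real
    using sum_squares_bound[of "\<bar>a\<bar>" "\<bar>b\<bar>"] mult_nonneg_nonneg[of "\<bar>a\<bar>" "\<bar>b\<bar>"]
    unfolding abs_mult power2_abs by linarith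
  then show "AE x in M. norm (f x * g x) \<le> norm ((f x)\<^sup>2 + (g x)\<^sup>2)" by auto
qed

lemma (in finite_measure) square_integrable_imp_integrable:
  "square_integrable M f \<Longrightarrow> integrable M f"
  using integrable_mult_square_integrable[of M f "\<lambda>_. 1"] by (simp add: square_integrable_def)

lemma square_integrable_scale:
  assumes "square_integrable M f" shows "square_integrable M (\<lambda>x. c * f x)"
  using assms by (auto simp: square_integrable_def power_mult_distrib)

lemma square_integrable_add:
  assumes f: "square_integrable M f" and g: "square_integrable M g"
  shows "square_integrable M (\<lambda>x. f x + g x)"
  using assms integrable_mult_square_integrable[OF assms]
  by (auto simp: square_integrable_def power2_sum mult.assoc)

lemma square_integrable_diff:
  assumes f: "square_integrable M f" and g: "square_integrable M g"
  shows "square_integrable M (\<lambda>x. f x - g x)"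
  using square_integrable_add[OF f square_integrable_scale[OF g, of "-1"]] by simp

lemma square_integrable_sum:
  assumes "\<And>i. i \<in> I \<Longrightarrow> square_integrable M (f i)"
  shows "square_integrable M (\<lambda>x. \<Sum>i\<in>I. f i x)"
  using assms
proof (induction I rule: infinite_finite_induct)
  case (insert i I)
  then show ?case using square_integrable_add[of M "f i"] by simp
qed (auto simp: square_integrable_def)

lemma square_integrable_lincomb:
  assumes "\<And>j. j < m \<Longrightarrow> square_integrable M (f j)"
  shows "square_integrable M (\<lambda>x. \<Sum>j<m. a j * f j x)"
  by (intro square_integrable_sum square_integrable_scale assms) auto

lemma L2_inner_lincomb:
  assumes f: "\<And>j. j < m \<Longrightarrow> square_integrable M (f j)" and g: "square_integrable M g"
  shows "L2_inner M (\<lambda>x. \<Sum>j<m. a j * f j x) g = (\<Sum>j<m. a j * L2_inner M (f j) g)"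
proof -
  have "(\<integral>x. (\<Sum>j<m. a j * (f j x * g x)) \<partial>M) = (\<Sum>j<m. \<integral>x. a j * (f j x * g x) \<partial>M)"
    by (intro Bochner_Integration.integral_sum integrable_mult_right
        integrable_mult_square_integrable f g) auto
  then show ?thesis by (simp add: L2_inner_def sum_distrib_right mult.assoc)
qed

lemma L2_inner_diff:
  assumes "square_integrable M f" "square_integrable M g" "square_integrable M h"
  shows "L2_inner M (\<lambda>x. f x - g x) h = L2_inner M f h - L2_inner M g h"
  unfolding L2_inner_def left_diff_distrib
  by (intro Bochner_Integration.integral_diff integrable_mult_square_integrable assms)

lemma fun_spanI: "J = (\<lambda>t. \<Sum>j<m. a j * \<phi> j t) \<Longrightarrow> J \<in> fun_span m \<phi>"
  by (auto simp: fun_span_def)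

lemma fun_spanE:
  assumes "J \<in> fun_span m \<phi>"
  obtains a where "J = (\<lambda>t. \<Sum>j<m. a j * \<phi> j t)"
  using assms by (auto simp: fun_span_def)

lemma fun_span_mono: "m \<le> n \<Longrightarrow> fun_span m \<phi> \<subseteq> fun_span n \<phi>"
proof
  fix J assume mn: "m \<le> n" and "J \<in> fun_span m \<phi>"
  then obtain a where J: "J = (\<lambda>t. \<Sum>j<m. a j * \<phi> j t)" by (blast elim: fun_spanE)
  have "J = (\<lambda>t. \<Sum>j<n. (if j < m then a j else 0) * \<phi> j t)"
    unfolding J using mn by (intro ext sum.mono_neutral_cong_left) auto
  then show "J \<in> fun_span n \<phi>" by (rule fun_spanI)
qed

lemma fun_span_base:
  assumes "j < m" shows "\<phi> j \<in> fun_span m \<phi>"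
proof -
  have "\<phi> j = (\<lambda>t. \<Sum>i<m. of_bool (i = j) * \<phi> i t)"
    using assms by (simp add: of_bool_def if_distrib[of "\<lambda>x. x * _"] cong: if_cong)
  then show ?thesis by (rule fun_spanI)
qed

lemma fun_span_lincomb:
  assumes "\<And>k. k < p \<Longrightarrow> f k \<in> fun_span m \<phi>"
  shows "(\<lambda>t. \<Sum>k<p. c k * f k t) \<in> fun_span m \<phi>"
proof -
  have "\<forall>k. \<exists>a. k < p \<longrightarrow> f k = (\<lambda>t. \<Sum>j<m. a j * \<phi> j t)"
    using assms by (auto simp: fun_span_def)
  then obtain a where a: "\<And>k. k < p \<Longrightarrow> f k = (\<lambda>t. \<Sum>j<m. a k j * \<phi> j t)" by metis
  have "(\<lambda>t. \<Sum>k<p. c k * f k t) = (\<lambda>t. \<Sum>j<m. (\<Sum>k<p. c k * a k j) * \<phi> j t)"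
  proof
    fix t
    have "(\<Sum>k<p. c k * f k t) = (\<Sum>k<p. \<Sum>j<m. c k * a k j * \<phi> j t)"
      by (simp add: a sum_distrib_left mult.assoc)
    also have "\<dots> = (\<Sum>j<m. \<Sum>k<p. c k * a k j * \<phi> j t)" by (rule sum.swap)
    finally show "(\<Sum>k<p. c k * f k t) = (\<Sum>j<m. (\<Sum>k<p. c k * a k j) * \<phi> j t)"
      by (simp add: sum_distrib_right)
  qed
  then show ?thesis by (rule fun_spanI)
qed

lemma fun_span_subset:
  assumes "\<And>k. k < p \<Longrightarrow> f k \<in> fun_span m \<phi>"
  shows "fun_span p f \<subseteq> fun_span m \<phi>"
  using fun_span_lincomb[OF assms] by (auto simp: fun_span_def)

definition orthonormal_family :: "'a measure \<Rightarrow> nat \<Rightarrow> (nat \<Rightarrow> 'a \<Rightarrow> real) \<Rightarrow> bool" where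
  "orthonormal_family M m \<psi> \<longleftrightarrow> (\<forall>k<m. square_integrable M (\<psi> k)) \<and>
     (\<forall>k<m. \<forall>l<m. L2_inner M (\<psi> k) (\<psi> l) = of_bool (k = l))"

lemma orthonormal_family_coefficient:
  assumes "orthonormal_family M m \<psi>" "k < m"
  shows "(\<Sum>l<m. c l * L2_inner M (\<psi> l) (\<psi> k)) = c k"
proof -
  have "(\<Sum>l<m. c l * L2_inner M (\<psi> l) (\<psi> k)) = (\<Sum>l<m. if l = k then c l else 0)"
    using assms by (intro sum.cong) (auto simp: orthonormal_family_def)
  then show ?thesis using assms(2) by simp
qed

text \<open>
  The second hypothesis says that the Gram matrix of the family is positive definite. It makes the
  residual of \<open>\<phi>\<^sub>m\<close> after projection on its predecessors have positive norm, because that residual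
  is a combination in which \<open>\<phi>\<^sub>m\<close> has coefficient \<open>1\<close>.
\<close>
lemma gram_schmidt_functions:
  fixes \<phi> :: "nat \<Rightarrow> real \<Rightarrow> real"
  assumes "\<And>j. j < m \<Longrightarrow> square_integrable M (\<phi> j)"
    and "\<And>a. \<exists>j<m. a j \<noteq> 0 \<Longrightarrow> 0 < (\<integral>t. (\<Sum>j<m. a j * \<phi> j t)\<^sup>2 \<partial>M)"
  shows "\<exists>\<psi>. orthonormal_family M m \<psi> \<and> fun_span m \<psi> = fun_span m \<phi>"
  using assms
proof (induction m)
  case 0
  then show ?case by (intro exI[of _ \<phi>]) (auto simp: orthonormal_family_def)
next
  case (Suc m)
  have pos: "0 < (\<integral>t. (\<Sum>j<m. a j * \<phi> j t)\<^sup>2 \<partial>M)" if "\<exists>j<m. a j \<noteq> 0" for a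
  proof -
    have "0 < (\<integral>t. (\<Sum>j<Suc m. (if j < m then a j else 0) * \<phi> j t)\<^sup>2 \<partial>M)"
      using that by (intro Suc.prems(2)) (auto intro: less_SucI)
    then show ?thesis by simp
  qed
  obtain \<psi> where on: "orthonormal_family M m \<psi>" and span: "fun_span m \<psi> = fun_span m \<phi>"
    using Suc.IH[OF Suc.prems(1) pos] by auto
  have sq: "square_integrable M (\<psi> k)" if "k < m" for k
    using on that by (simp add: orthonormal_family_def)
  have sq_phi: "square_integrable M (\<phi> m)" using Suc.prems(1) by simp
  define p where "p = (\<lambda>t. \<Sum>k<m. L2_inner M (\<phi> m) (\<psi> k) * \<psi> k t)"
  define r where "r = (\<lambda>t. \<phi> m t - p t)"
  have sq_p: "square_integrable M p"
    unfolding p_def by (rule square_integrable_lincomb) (rule sq)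
  have sq_r: "square_integrable M r"
    unfolding r_def by (intro square_integrable_diff sq_phi sq_p)
  have "p \<in> fun_span m \<phi>"
    unfolding span[symmetric] by (rule fun_spanI) (rule p_def)
  then obtain a where a: "p = (\<lambda>t. \<Sum>j<m. a j * \<phi> j t)" by (rule fun_spanE)
  have r_comb: "r = (\<lambda>t. \<Sum>j<Suc m. (if j = m then 1 else - a j) * \<phi> j t)"
    by (simp add: r_def a sum_negf)
  have r_span: "r \<in> fun_span (Suc m) \<phi>"
    by (rule fun_spanI) (rule r_comb)
  define \<beta> where "\<beta> = L2_inner M r r"
  have "\<beta> > 0"
    unfolding \<beta>_def L2_inner_self r_comb by (rule Suc.prems(2)) (auto intro!: exI[of _ m])
  have r_orth: "L2_inner M r (\<psi> k) = 0" if "k < m" for k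
  proof -
    have "L2_inner M p (\<psi> k) = (\<Sum>l<m. L2_inner M (\<phi> m) (\<psi> l) * L2_inner M (\<psi> l) (\<psi> k))"
      unfolding p_def by (rule L2_inner_lincomb) (use sq that in auto)
    also have "\<dots> = L2_inner M (\<phi> m) (\<psi> k)"
      by (rule orthonormal_family_coefficient[OF on that])
    finally show ?thesis
      unfolding r_def by (simp add: L2_inner_diff sq_phi sq_p sq that)
  qed
  define \<psi>' where "\<psi>' = (\<lambda>k. if k < m then \<psi> k else (\<lambda>t. 1 / sqrt \<beta> * r t))"
  have scale: "L2_inner M (\<lambda>t. c * f t) g = c * L2_inner M f g" for c f g
    by (simp add: L2_inner_def mult.assoc)
  have scale': "L2_inner M f (\<lambda>t. c * g t) = c * L2_inner M f g" for c f g
    using scale[of c g f] by (simp add: L2_inner_commute)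
  have "orthonormal_family M (Suc m) \<psi>'"
    unfolding orthonormal_family_def
  proof (intro conjI allI impI)
    fix k assume k: "k < Suc m"
    show "square_integrable M (\<psi>' k)"
      using sq square_integrable_scale[OF sq_r] by (simp add: \<psi>'_def del: times_divide_eq_left)
    fix l assume l: "l < Suc m"
    consider "k < m" "l < m" | "k < m" "l = m" | "k = m" "l < m" | "k = m" "l = m"
      using k l by linarith
    then show "L2_inner M (\<psi>' k) (\<psi>' l) = of_bool (k = l)"
    proof cases
      case 1 then show ?thesis using on by (simp add: \<psi>'_def orthonormal_family_def)
    next
      case 2 then show ?thesis
        using r_orth[of k] L2_inner_commute[of M "\<psi> k" r]
        by (simp add: \<psi>'_def scale' del: times_divide_eq_left)
    next
      case 3 then show ?thesis
        using r_orth[of l] by (simp add: \<psi>'_def scale del: times_divide_eq_left)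
    next
      case 4
      show ?thesis
      proof -
        have "L2_inner M (\<psi>' k) (\<psi>' l) = 1 / sqrt \<beta> * (1 / sqrt \<beta> * \<beta>)"
          using 4 by (simp add: \<psi>'_def scale scale' \<beta>_def[symmetric] del: times_divide_eq_left)
        also have "\<dots> = 1" using \<open>\<beta> > 0\<close> by (simp add: field_simps)
        finally show ?thesis using 4 by simp
      qed
    qed
  qed
  moreover have "fun_span (Suc m) \<psi>' \<subseteq> fun_span (Suc m) \<phi>"
  proof (rule fun_span_subset)
    fix k assume k: "k < Suc m"
    show "\<psi>' k \<in> fun_span (Suc m) \<phi>"
    proof (cases "k < m")
      case True
      then have "\<psi> k \<in> fun_span m \<phi>" using fun_span_base span by blast
      then show ?thesis using True fun_span_mono[of m "Suc m" \<phi>] by (auto simp: \<psi>'_def)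
    next
      case False
      then show ?thesis
        using fun_span_lincomb[of "Suc 0" "\<lambda>_. r" "Suc m" \<phi> "\<lambda>_. 1 / sqrt \<beta>"] r_span
        by (simp add: \<psi>'_def lessThan_Suc)
    qed
  qed
  moreover have "fun_span (Suc m) \<phi> \<subseteq> fun_span (Suc m) \<psi>'"
  proof (rule fun_span_subset)
    fix k assume k: "k < Suc m"
    show "\<phi> k \<in> fun_span (Suc m) \<psi>'"
    proof (cases "k < m")
      case True
      then have "\<phi> k \<in> fun_span m \<psi>" using fun_span_base span by blast
      also have "fun_span m \<psi> = fun_span m \<psi>'"
        by (simp add: fun_span_def \<psi>'_def)
      finally show ?thesis using fun_span_mono[of m "Suc m" \<psi>'] by auto
    next
      case False
      have "\<phi> m = (\<lambda>t. \<Sum>k<Suc m. (if k = m then sqrt \<beta> else L2_inner M (\<phi> m) (\<psi> k)) * \<psi>' k t)"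
        using \<open>\<beta> > 0\<close> by (auto simp: \<psi>'_def r_def p_def)
      then have "\<phi> m \<in> fun_span (Suc m) \<psi>'" by (rule fun_spanI)
      then show ?thesis using False k by (simp add: less_Suc_eq)
    qed
  qed
  ultimately show ?case by blast
qed

text \<open>
  Completing the square: by orthonormality the squared norm of the combination is \<open>\<Sum>\<^sub>k c\<^sub>k\<^sup>2\<close> and its
  inner product with \<open>f\<close> is \<open>\<Sum>\<^sub>k c\<^sub>k d\<^sub>k\<close>, where \<open>d\<^sub>k\<close> is the inner product of \<open>f\<close> and \<open>\<psi>\<^sub>k\<close>.
\<close>
lemma orthonormal_sqdist:
  assumes on: "orthonormal_family M m \<psi>" and f: "square_integrable M f"
  shows "(\<integral>x. ((\<Sum>k<m. c k * \<psi> k x) - f x)\<^sup>2 \<partial>M)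
    = (\<integral>x. (f x)\<^sup>2 \<partial>M) - (\<Sum>k<m. (L2_inner M f (\<psi> k))\<^sup>2)
      + (\<Sum>k<m. (c k - L2_inner M f (\<psi> k))\<^sup>2)"
proof -
  let ?u = "\<lambda>x. \<Sum>k<m. c k * \<psi> k x"
  have sq: "square_integrable M (\<psi> k)" if "k < m" for k
    using on that by (simp add: orthonormal_family_def)
  have u: "square_integrable M ?u" by (rule square_integrable_lincomb) (rule sq)
  have up: "L2_inner M ?u (\<psi> k) = c k" if "k < m" for k
    using L2_inner_lincomb[of m M \<psi> "\<psi> k" c] sq orthonormal_family_coefficient[OF on that, of c]
    by (simp add: that)
  have uf: "L2_inner M ?u f = (\<Sum>k<m. c k * L2_inner M f (\<psi> k))"
    using L2_inner_lincomb[of m M \<psi> f c] sq f by (simp add: L2_inner_commute)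
  have uu: "L2_inner M ?u ?u = (\<Sum>k<m. (c k)\<^sup>2)"
  proof -
    have "L2_inner M (\<psi> k) ?u = c k" if "k < m" for k
      using up[OF that] L2_inner_commute[of M "\<psi> k" ?u] by simp
    then have "(\<Sum>k<m. c k * L2_inner M (\<psi> k) ?u) = (\<Sum>k<m. (c k)\<^sup>2)"
      by (simp add: power2_eq_square)
    then show ?thesis
      using L2_inner_lincomb[where f = \<psi> and m = m and a = c, OF sq u] by simp
  qed
  have d: "square_integrable M (\<lambda>x. ?u x - f x)" by (intro square_integrable_diff u f)
  have "(\<integral>x. (?u x - f x)\<^sup>2 \<partial>M) = L2_inner M (\<lambda>x. ?u x - f x) (\<lambda>x. ?u x - f x)"
    by (simp add: L2_inner_self)
  also have "\<dots> = L2_inner M ?u ?u - 2 * L2_inner M ?u f + L2_inner M f f"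
    using L2_inner_diff[OF u f d] L2_inner_diff[OF u f u] L2_inner_diff[OF u f f]
      L2_inner_commute[of M f ?u] L2_inner_commute[of M ?u "\<lambda>x. ?u x - f x"]
      L2_inner_commute[of M f "\<lambda>x. ?u x - f x"] by linarith
  also have "\<dots> = (\<integral>x. (f x)\<^sup>2 \<partial>M) - (\<Sum>k<m. (L2_inner M f (\<psi> k))\<^sup>2)
      + (\<Sum>k<m. (c k - L2_inner M f (\<psi> k))\<^sup>2)"
    by (simp add: uu[unfolded L2_inner_self] uf L2_inner_self power2_diff sum.distrib sum_subtractf sum_distrib_left algebra_simps)
  finally show ?thesis .
qed

text \<open>
  The last sum in \<open>orthonormal_sqdist\<close> vanishes exactly for the orthogonal projection of \<open>f\<close>, so the
  infimum over the span is attained there. This matters because \<^const>\<open>Least\<close> on the reals is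
  meaningful only for an attained minimum.
\<close>
lemma least_sqdist:
  assumes on: "orthonormal_family M m \<psi>" and span: "fun_span m \<psi> = fun_span m \<phi>"
    and f: "square_integrable M f"
  shows least_sqdist_eq: "(LEAST x. x \<in> (\<lambda>v. \<integral>x. (v x - f x)\<^sup>2 \<partial>M) ` fun_span m \<phi>)
      = (\<integral>x. (f x)\<^sup>2 \<partial>M) - (\<Sum>k<m. (L2_inner M f (\<psi> k))\<^sup>2)"
    and least_sqdist_nonneg: "0 \<le> (LEAST x. x \<in> (\<lambda>v. \<integral>x. (v x - f x)\<^sup>2 \<partial>M) ` fun_span m \<phi>)"
proof -
  let ?d = "\<lambda>k. L2_inner M f (\<psi> k)"
  let ?N = "\<lambda>v. \<integral>x. (v x - f x)\<^sup>2 \<partial>M"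
  let ?min = "(\<integral>x. (f x)\<^sup>2 \<partial>M) - (\<Sum>k<m. (?d k)\<^sup>2)"
  define p where "p = (\<lambda>t. \<Sum>k<m. ?d k * \<psi> k t)"
  have p: "p \<in> fun_span m \<phi>"
    unfolding span[symmetric] by (rule fun_spanI) (rule p_def)
  have min_eq: "?min = ?N p"
    unfolding p_def using orthonormal_sqdist[OF on f, of ?d] by simp
  show eq: "(LEAST x. x \<in> ?N ` fun_span m \<phi>) = ?min"
  proof (rule Least_equality)
    show "?min \<in> ?N ` fun_span m \<phi>" using min_eq p by (rule image_eqI)
    fix y assume "y \<in> ?N ` fun_span m \<phi>"
    then obtain v where v: "v \<in> fun_span m \<psi>" and y: "y = ?N v" using span by auto
    from v obtain c where "v = (\<lambda>t. \<Sum>k<m. c k * \<psi> k t)" by (rule fun_spanE)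
    then show "?min \<le> y"
      unfolding y using orthonormal_sqdist[OF on f, of c] by (simp add: sum_nonneg)
  qed
  show "0 \<le> (LEAST x. x \<in> ?N ` fun_span m \<phi>)" unfolding eq min_eq by simp
qed

text \<open>
  Pythagoras' theorem in the form used for the estimator: the excess over the best approximation is
  the squared difference of the coefficients in an orthonormal basis.
\<close>
lemma sqdist_eq_least_plus:
  assumes on: "orthonormal_family M m \<psi>" and span: "fun_span m \<psi> = fun_span m \<phi>"
    and f: "square_integrable M f" and u: "u \<in> fun_span m \<phi>"
  shows "(\<integral>x. (u x - f x)\<^sup>2 \<partial>M)
    = (LEAST x. x \<in> (\<lambda>v. \<integral>x. (v x - f x)\<^sup>2 \<partial>M) ` fun_span m \<phi>)
      + (\<Sum>k<m. (L2_inner M u (\<psi> k) - L2_inner M f (\<psi> k))\<^sup>2)"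
proof -
  have sq: "square_integrable M (\<psi> k)" if "k < m" for k
    using on that by (simp add: orthonormal_family_def)
  obtain c where c: "u = (\<lambda>t. \<Sum>k<m. c k * \<psi> k t)"
    using u unfolding span[symmetric] by (rule fun_spanE)
  have "L2_inner M u (\<psi> k) = c k" if "k < m" for k
    unfolding c using L2_inner_lincomb[of m M \<psi> "\<psi> k" c] sq orthonormal_family_coefficient[OF on that, of c]
    by (simp add: that)
  then show ?thesis
    using orthonormal_sqdist[OF on f, of c] c least_sqdist_eq[OF on span f] by simp
qed

section \<open>Gram matrices and normal equations\<close>

text \<open>
  The normal equations. A vector in the kernel of the Gram matrix would be the coefficient vector of
  a function of norm \<open>0\<close>, so positive definiteness makes the Gram matrix invertible and
  \<^const>\<open>mat_inverse\<close> returns its inverse.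
\<close>
lemma gram_matrix_inverse_solves:
  fixes \<phi> :: "nat \<Rightarrow> real \<Rightarrow> real"
  assumes sq: "\<And>j. j < m \<Longrightarrow> square_integrable M (\<phi> j)"
    and pos: "\<And>a. \<exists>j<m. a j \<noteq> 0 \<Longrightarrow> 0 < (\<integral>t. (\<Sum>j<m. a j * \<phi> j t)\<^sup>2 \<partial>M)"
    and z: "z \<in> carrier_vec m" and j: "j < m"
  defines "G \<equiv> Matrix.mat m m (\<lambda>(j, k). L2_inner M (\<phi> j) (\<phi> k))"
  shows "L2_inner M (\<lambda>t. \<Sum>k<m. vec_index (the (mat_inverse G) *\<^sub>v z) k * \<phi> k t) (\<phi> j) = vec_index z j"
proof -
  have G: "G \<in> carrier_mat m m" by (simp add: G_def)
  have apply_G: "vec_index (G *\<^sub>v v) i = L2_inner M (\<lambda>t. \<Sum>k<m. vec_index v k * \<phi> k t) (\<phi> i)"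
    if v: "v \<in> carrier_vec m" and i: "i < m" for v i
  proof -
    have "vec_index (G *\<^sub>v v) i = (\<Sum>k<m. L2_inner M (\<phi> i) (\<phi> k) * vec_index v k)"
      using v i by (simp add: G_def scalar_prod_def atLeast0LessThan)
    also have "\<dots> = L2_inner M (\<lambda>t. \<Sum>k<m. vec_index v k * \<phi> k t) (\<phi> i)"
      using L2_inner_lincomb[where f = \<phi> and m = m, OF sq sq[OF i], of "vec_index v"]
      by (simp add: L2_inner_commute[of M "\<phi> i"] mult.commute)
    finally show ?thesis .
  qed
  have "Determinant.det G \<noteq> 0"
  proof
    assume "Determinant.det G = 0"
    then obtain v where v: "v \<in> carrier_vec m" "v \<noteq> 0\<^sub>v m" and Gv: "G *\<^sub>v v = 0\<^sub>v m"
      using det_0_iff_vec_prod_zero_field[OF G] by auto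
    let ?u = "\<lambda>t. \<Sum>k<m. vec_index v k * \<phi> k t"
    have "\<exists>k<m. vec_index v k \<noteq> 0"
      using v by (metis carrier_vecD eq_vecI index_zero_vec)
    then have "0 < L2_inner M ?u ?u" unfolding L2_inner_self by (rule pos)
    also have "L2_inner M ?u ?u = (\<Sum>k<m. vec_index v k * L2_inner M (\<phi> k) ?u)"
      by (rule L2_inner_lincomb) (use sq in \<open>auto intro: square_integrable_lincomb\<close>)
    also have "\<dots> = 0"
    proof (rule sum.neutral, rule ballI)
      fix k assume "k \<in> {..<m}"
      then have "L2_inner M ?u (\<phi> k) = 0"
        using apply_G[OF v(1), of k] Gv by simp
      then show "vec_index v k * L2_inner M (\<phi> k) ?u = 0"
        using L2_inner_commute[of M "\<phi> k" ?u] by simp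
    qed
    finally show False by simp
  qed
  then have "G \<in> Units (ring_mat TYPE(real) m ())"
    by (rule det_non_zero_imp_unit[OF G])
  then obtain H where H: "mat_inverse G = Some H"
    using mat_inverse(1)[OF G, where b = "()"] by (cases "mat_inverse G") auto
  have inv: "G * H = 1\<^sub>m m" "H \<in> carrier_mat m m" using mat_inverse(2)[OF G H] by auto
  have "G *\<^sub>v (H *\<^sub>v z) = z"
    using assoc_mult_mat_vec[OF G inv(2) z] inv z by simp
  moreover have "H *\<^sub>v z \<in> carrier_vec m" using inv(2) z by simp
  ultimately show ?thesis using apply_G[of "H *\<^sub>v z" j] j by (simp add: H)
qed

section \<open>Lebesgue--Stieltjes measures with a density\<close>

text \<open>
  A finite Borel measure on the line is determined by its distribution function, and both measures
  have the distribution function \<open>t \<mapsto> V (max 0 (min t T))\<close>. Taking it from the measure with density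
  also supplies the monotonicity and right continuity on which \<^const>\<open>interval_measure\<close> relies.
\<close>
lemma stieltjes_eq_density:
  fixes mu V :: "real \<Rightarrow> real"
  assumes T: "0 \<le> T" and int: "set_integrable lborel {0<..T} mu"
    and nonneg: "\<forall>t\<in>{0<..T}. 0 \<le> mu t"
    and V: "\<forall>t\<in>{0..T}. V t = (LINT s:{0<..t}|lborel. mu s)"
  shows "stieltjes T V = density lborel (\<lambda>s. ennreal (indicator {0<..T} s * mu s))"
proof -
  let ?h = "\<lambda>s. indicator {0<..T} s * mu s"
  define D where "D = density lborel (\<lambda>s. ennreal (?h s))"
  have h_int: "integrable lborel ?h"
    using int by (simp add: set_integrable_def)
  note [measurable] = borel_measurable_integrable[OF h_int]
  have h_nn: "0 \<le> ?h s" for s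
    using nonneg by (auto simp: indicator_def)
  have em: "emeasure D A = ennreal (LINT s:A|lborel. ?h s)" if [measurable]: "A \<in> sets borel" for A
  proof -
    have "emeasure D A = (\<integral>\<^sup>+s. ennreal (indicator A s *\<^sub>R ?h s) \<partial>lborel)"
      unfolding D_def
      by (subst emeasure_density, measurable, simp) (auto intro!: nn_integral_cong simp: indicator_def)
    also have "\<dots> = ennreal (LINT s:A|lborel. ?h s)"
      unfolding set_lebesgue_integral_def
    proof (rule nn_integral_eq_integral)
      show "integrable lborel (\<lambda>s. indicator A s *\<^sub>R ?h s)"
        by (rule integrable_mult_indicator[OF _ h_int]) simp
      show "AE s in lborel. 0 \<le> indicator A s *\<^sub>R ?h s"
        by (rule AE_I2) (metis h_nn indicator_pos_le scaleR_nonneg_nonneg)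
    qed
    finally show ?thesis .
  qed
  have sets_D: "sets D = sets borel" by (simp add: D_def)
  have space_D: "space D = UNIV" by (simp add: D_def)
  have "finite_measure D"
    by (rule finite_measureI) (simp add: space_D em)
  then interpret D: finite_borel_measure D
    unfolding finite_borel_measure_def finite_borel_measure_axioms_def using sets_D by blast
  have cdf: "cdf D x = V (max 0 (min x T))" for x
  proof -
    have "cdf D x = (LINT s:{..x}|lborel. ?h s)"
    proof -
      have "0 \<le> (LINT s:{..x}|lborel. ?h s)"
        unfolding set_lebesgue_integral_def using h_nn by (intro integral_nonneg_AE) auto
      then show ?thesis by (simp add: cdf_def2 measure_def em)
    qed
    also have "\<dots> = (LINT s:{0<..max 0 (min x T)}|lborel. mu s)"
      unfolding set_lebesgue_integral_def
      by (intro Bochner_Integration.integral_cong refl) (auto simp: indicator_def max_def min_def)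
    also have "\<dots> = V (max 0 (min x T))" using V T by (simp add: max_def min_def)
    finally show ?thesis .
  qed
  have F: "(\<lambda>t. V (max 0 (min t T))) = cdf D" using cdf by auto
  have V0: "V 0 = 0" using V T by (simp add: set_lebesgue_integral_def)
  have bot: "(cdf D \<longlongrightarrow> 0) at_bot"
    by (rule tendsto_eventually, unfold eventually_at_bot_linorder, rule exI[of _ 0])
      (use V0 T in \<open>auto simp: cdf max_def min_def\<close>)
  have top: "(cdf D \<longlongrightarrow> V T) at_top"
    by (rule tendsto_eventually, unfold eventually_at_top_linorder, rule exI[of _ T])
      (use T in \<open>auto simp: cdf max_def min_def\<close>)
  have VT: "0 \<le> V T" using D.cdf_nonneg[of T] T by (simp add: cdf max_def)
  have "interval_measure (cdf D) = D"
  proof (rule cdf_unique')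
    show "finite_borel_measure (interval_measure (cdf D))"
      by (rule finite_borel_measure_interval_measure[OF _ _ bot top VT])
        (auto intro: D.cdf_nondecreasing D.cdf_is_right_cont)
    show "cdf (interval_measure (cdf D)) = cdf D"
      by (rule cdf_interval_measure[OF _ _ bot])
        (auto intro: D.cdf_nondecreasing D.cdf_is_right_cont)
  qed (rule D.finite_borel_measure_axioms)
  then show ?thesis by (simp add: stieltjes_def F D_def)
qed

text \<open>
  The half-open cells cover \<open>{0<..T}\<close> only, which is why \<open>0\<close> must carry no mass.
\<close>
lemma sum_partition_set_integral:
  fixes f :: "real \<Rightarrow> real"
  assumes "0 < n" "0 < T" and sets: "sets \<nu> = sets borel" and null: "emeasure \<nu> {0} = 0"
    and int: "set_integrable \<nu> {0..T} f"
  shows "(\<Sum>l<n. LINT s:{real l * T / real n<..real (Suc l) * T / real n}|\<nu>. f s)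
    = (LINT s:{0..T}|\<nu>. f s)"
proof -
  let ?t = "\<lambda>l. real l * T / real n"
  have t_mono: "?t l \<le> ?t k" if "l \<le> k" for l k
    using that assms(1,2) by (intro divide_right_mono mult_right_mono) auto
  have tn: "?t n = T" using assms(1) by simp
  have mono: "set_integrable \<nu> A f" if "A \<subseteq> {0..T}" "A \<in> sets borel" for A
    using set_integrable_subset[OF int] that sets by auto
  have "k \<le> n \<Longrightarrow> (\<Sum>l<k. LINT s:{?t l<..?t (Suc l)}|\<nu>. f s) = (LINT s:{0<..?t k}|\<nu>. f s)" for k
  proof (induction k)
    case 0 show ?case by (simp add: set_lebesgue_integral_def)
  next
    case (Suc k)
    have le: "?t (Suc k) \<le> T" using t_mono[OF Suc.prems] tn by simp
    have k0: "0 \<le> ?t k" using assms(1,2) by simp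
    have kk: "?t k \<le> ?t (Suc k)" by (rule t_mono) simp
    have "(LINT s:{0<..?t k} \<union> {?t k<..?t (Suc k)}|\<nu>. f s)
       = (LINT s:{0<..?t k}|\<nu>. f s) + (LINT s:{?t k<..?t (Suc k)}|\<nu>. f s)"
      by (intro set_integral_Un mono) (use le k0 kk in auto)
    moreover have "{0<..?t k} \<union> {?t k<..?t (Suc k)} = {0<..?t (Suc k)}"
      using k0 kk by auto
    ultimately show ?case using Suc by simp
  qed
  from this[of n] have "(\<Sum>l<n. LINT s:{?t l<..?t (Suc l)}|\<nu>. f s) = (LINT s:{0<..T}|\<nu>. f s)"
    using tn by simp
  also have "\<dots> = (LINT s:{0..T}|\<nu>. f s)"
  proof -
    have "AE s in \<nu>. s \<noteq> 0"
      by (rule AE_I'[of "{0}"]) (use null sets in auto)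
    then show ?thesis
      using mono[of "{0<..T}", OF greaterThanAtMost_subseteq_atLeastAtMost_iff[THEN iffD2]] mono[of "{0..T}"]
      unfolding set_lebesgue_integral_def set_integrable_def
      by (intro integral_cong_AE)
        (auto intro!: borel_measurable_integrable elim: eventually_mono simp: indicator_def)
  qed
  finally show ?thesis .
qed

text \<open>
  The analytic part of the setting: \<open>V\<close> is the deterministic bracket, and \<open>\<delta>\<close> is the lower bound on
  its density that results from the continuity of \<open>1/\<mu>\<close> on the compact interval. The measure \<open>dV\<close>
  is considered on \<open>[0,T]\<close> alone (\<open>\<rho>\<close>), since the functions involved are arbitrary, possibly
  nonmeasurable, outside of it.
\<close>
locale bracket_density =
  fixes T \<delta> :: real and mu V :: "real \<Rightarrow> real"
  assumes T_pos: "0 < T" and \<delta>_pos: "0 < \<delta>"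
    and mu_ge: "t \<in> {0<..T} \<Longrightarrow> \<delta> \<le> mu t"
    and mu_int: "set_integrable lborel {0<..T} mu"
    and V_eq: "t \<in> {0..T} \<Longrightarrow> V t = (LINT s:{0<..t}|lborel. mu s)"
begin

abbreviation \<nu> :: "real measure" where "\<nu> \<equiv> stieltjes T V"
abbreviation \<rho> :: "real measure" where "\<rho> \<equiv> restrict_space \<nu> {0..T}"

definition dens :: "real \<Rightarrow> real" where "dens s = indicator {0<..T} s * mu s"

lemma \<nu>_eq: "\<nu> = density lborel (\<lambda>s. ennreal (dens s))"
  unfolding dens_def
  by (rule stieltjes_eq_density) (use T_pos \<delta>_pos mu_ge mu_int V_eq in force)+

lemma dens_nonneg: "0 \<le> dens s"
  using mu_ge[of s] \<delta>_pos by (auto simp: dens_def indicator_def)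

lemma dens_integrable: "integrable lborel dens"
  using mu_int by (simp add: dens_def[abs_def] set_integrable_def)

lemma dens_measurable [measurable]: "dens \<in> borel_measurable borel"
  using borel_measurable_integrable[OF dens_integrable] by simp

lemma sets_\<nu>: "sets \<nu> = sets borel" by (simp add: \<nu>_eq)
lemma space_\<nu>: "space \<nu> = UNIV" by (simp add: \<nu>_eq)

lemma emeasure_\<nu>: "A \<in> sets borel \<Longrightarrow> emeasure \<nu> A = (\<integral>\<^sup>+s. ennreal (dens s) * indicator A s \<partial>lborel)"
  by (simp add: \<nu>_eq emeasure_density)

lemma \<nu>_null: "emeasure \<nu> {0} = 0"
proof -
  have "(\<lambda>s. ennreal (dens s) * indicator {0} s) = (\<lambda>_. 0)"
    by (auto simp: dens_def indicator_def)
  then show ?thesis by (simp add: emeasure_\<nu>)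
qed

lemma finite_\<nu>: "finite_measure \<nu>"
proof (rule finite_measureI)
  have "(\<integral>\<^sup>+s. ennreal (dens s) \<partial>lborel) = ennreal (\<integral>s. dens s \<partial>lborel)"
    by (rule nn_integral_eq_integral[OF dens_integrable]) (simp add: dens_nonneg)
  then show "emeasure \<nu> (space \<nu>) \<noteq> \<infinity>" by (simp add: space_\<nu> emeasure_\<nu>)
qed

lemma finite_\<rho>: "finite_measure \<rho>"
  by (rule finite_measure_restrict_space[OF finite_\<nu>]) (simp add: sets_\<nu>)

lemma set_integral_\<rho>: "(LINT s:{0..T}|\<nu>. f s) = (\<integral>s. f s \<partial>\<rho>)" for f :: "real \<Rightarrow> real"
  unfolding set_lebesgue_integral_def
  by (rule integral_restrict_space[symmetric]) (simp add: sets_\<nu> space_\<nu>)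

lemma set_integrable_\<rho>: "set_integrable \<nu> {0..T} f \<longleftrightarrow> integrable \<rho> f" for f :: "real \<Rightarrow> real"
  unfolding set_integrable_def
  by (rule integrable_restrict_space[symmetric]) (simp add: sets_\<nu> space_\<nu>)

lemma bracket_sqnorm_eq: "bracket_sqnorm T V f = (\<integral>s. (f s)\<^sup>2 \<partial>\<rho>)"
  by (simp add: bracket_sqnorm_def set_integral_\<rho>)

lemma in_L2_iff: "in_L2 T V f \<longleftrightarrow> square_integrable \<rho> f"
  unfolding in_L2_def square_integrable_def set_integrable_\<rho> set_borel_measurable_def
  by (subst borel_measurable_restrict_space_iff) (simp_all add: sets_\<nu> space_\<nu>)

lemma continuous_square_integrable:
  assumes "continuous_on {0..T} f"
  shows "square_integrable \<rho> f"
proof -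
  have "f \<in> borel_measurable (restrict_space borel {0..T})"
    by (rule borel_measurable_continuous_on_restrict[OF assms])
  then have meas: "f \<in> borel_measurable \<rho>"
    using measurable_cong_sets[OF sets_restrict_space_cong[OF sets_\<nu>] refl] by blast
  have "bounded (f ` {0..T})"
    by (intro compact_imp_bounded compact_continuous_image assms) simp
  then obtain B where B: "\<And>s. s \<in> {0..T} \<Longrightarrow> \<bar>f s\<bar> \<le> B"
    unfolding bounded_iff by (metis imageI real_norm_def)
  interpret finite_measure \<rho> by (rule finite_\<rho>)
  have "integrable \<rho> (\<lambda>s. (f s)\<^sup>2)"
  proof (rule integrable_const_bound[where B = "B\<^sup>2"])
    show "AE s in \<rho>. norm ((f s)\<^sup>2) \<le> B\<^sup>2"
      using B abs_le_square_iff[of "f _" B]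
      by (intro AE_I2) (force simp: space_restrict_space space_\<nu> intro: order_trans[OF B] abs_ge_self)
  qed (use meas in measurable)
  then show ?thesis using meas by (simp add: square_integrable_def)
qed

text \<open>
  This is where the lower bound on the density enters: \<open>dV \<ge> \<delta> dt\<close> on \<open>[0,T]\<close>.
\<close>
lemma sqnorm_ge_lebesgue:
  assumes cont: "continuous_on {0..T} u"
  shows "\<delta> * (LINT t:{0..T}|lborel. (u t)\<^sup>2) \<le> (\<integral>s. (u s)\<^sup>2 \<partial>\<rho>)"
proof -
  let ?f = "\<lambda>s. indicator {0..T} s *\<^sub>R (u s)\<^sup>2"
  have "set_integrable lborel {0..T} (\<lambda>s. (u s)\<^sup>2)"
    unfolding set_integrable_def
    by (rule borel_integrable_compact) (auto intro: continuous_intros cont)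
  then have int: "integrable lborel ?f" by (simp add: set_integrable_def)
  have [measurable]: "(\<lambda>s. indicator {0..T} s * (u s)\<^sup>2) \<in> borel_measurable borel"
    using borel_measurable_integrable[OF int] by (simp del: indicator_simps split del: if_split)
  have "integrable \<nu> ?f"
    using continuous_square_integrable[OF cont] set_integrable_\<rho>[of "\<lambda>s. (u s)\<^sup>2"]
    by (simp add: square_integrable_def set_integrable_def)
  then have int': "integrable lborel (\<lambda>s. dens s * ?f s)"
    unfolding \<nu>_eq by (subst (asm) integrable_density) (auto simp: dens_nonneg)
  have "(\<integral>s. (u s)\<^sup>2 \<partial>\<rho>) = (\<integral>s. ?f s \<partial>\<nu>)"
    by (simp add: set_integral_\<rho>[symmetric] set_lebesgue_integral_def)
  also have "\<dots> = (\<integral>s. dens s * ?f s \<partial>lborel)"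
    unfolding \<nu>_eq by (subst integral_density) (auto simp: dens_nonneg)
  also have "\<dots> \<ge> (\<integral>s. \<delta> * ?f s \<partial>lborel)"
  proof (rule integral_mono_AE[OF _ int'])
    show "integrable lborel (\<lambda>s. \<delta> * ?f s)" using int by simp
    have "AE s in lborel. s \<noteq> (0::real)" by (rule AE_lborel_singleton)
    then show "AE s in lborel. \<delta> * ?f s \<le> dens s * ?f s"
    proof eventually_elim
      case (elim s)
      show ?case
      proof (cases "s \<in> {0..T}")
        case True
        then have "\<delta> \<le> dens s" using elim mu_ge[of s] by (auto simp: dens_def)
        then show ?thesis by (intro mult_right_mono) auto
      qed simp
    qed
  qed
  finally show ?thesis by (simp add: set_lebesgue_integral_def)
qed

lemma V_diff:
  assumes "0 \<le> s" "s \<le> t" "t \<le> T"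
  shows "V t - V s = (LINT x:{s<..t}|\<nu>. 1)"
proof -
  have "(LINT x:{s<..t}|\<nu>. 1) = (\<integral>x. dens x * indicator {s<..t} x \<partial>lborel)"
    unfolding set_lebesgue_integral_def \<nu>_eq by (subst integral_density) (auto simp: dens_nonneg)
  also have "\<dots> = (LINT x:{s<..t}|lborel. mu x)"
    unfolding set_lebesgue_integral_def using assms
    by (intro Bochner_Integration.integral_cong refl) (auto simp: dens_def indicator_def)
  also have "\<dots> = V t - V s"
  proof -
    have "{0<..s} \<union> {s<..t} = {0<..t}" using assms by auto
    moreover have "(LINT x:{0<..s} \<union> {s<..t}|lborel. mu x)
      = (LINT x:{0<..s}|lborel. mu x) + (LINT x:{s<..t}|lborel. mu x)"
      by (intro set_integral_Un set_integrable_subset[OF mu_int]) (use assms in auto)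
    ultimately show ?thesis using V_eq[of s] V_eq[of t] assms by simp
  qed
  finally show ?thesis by simp
qed

lemma V_T: "V T = (\<integral>s. 1 \<partial>\<rho>)"
proof -
  have "V 0 = 0" using V_eq[of 0] T_pos by (simp add: set_lebesgue_integral_def)
  then have "V T = (LINT x:{0<..T}|\<nu>. 1)" using V_diff[of 0 T] T_pos by simp
  also have "\<dots> = (LINT x:{0..T}|\<nu>. 1)"
  proof -
    have "set_integrable \<nu> {0..T} (\<lambda>_. 1::real)"
      by (simp add: set_integrable_\<rho> finite_measure.integrable_const[OF finite_\<rho>])
    from sum_partition_set_integral[OF _ T_pos sets_\<nu> \<nu>_null this, of 1]
    show ?thesis by simp
  qed
  finally show ?thesis by (simp add: set_integral_\<rho>)
qed

lemma partition_point:
  assumes "0 < n" "l \<le> n"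
  shows "real l * T / real n \<in> {0..T}"
  using assms T_pos by (auto simp: field_simps)

lemma partition_step:
  assumes "0 < n"
  shows "real l * T / real n \<le> real (Suc l) * T / real n"
  using T_pos by (intro divide_right_mono mult_right_mono) auto

lemma partition_cell_subset:
  assumes "0 < n" "l < n"
  shows "{real l * T / real n<..real (Suc l) * T / real n} \<subseteq> {0..T}"
  using partition_point[OF assms(1), of l] partition_point[OF assms(1), of "Suc l"] assms(2)
  by auto

lemma set_integrable_cell:
  fixes f :: "real \<Rightarrow> real"
  assumes "integrable \<rho> f" "0 < n" "l < n"
  shows "set_integrable \<nu> {real l * T / real n<..real (Suc l) * T / real n} f"
  by (rule set_integrable_subset[of _ "{0..T}"])
    (use assms partition_cell_subset in \<open>auto simp: set_integrable_\<rho> sets_\<nu>\<close>)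

lemma sum_partition_\<rho>:
  fixes f :: "real \<Rightarrow> real"
  assumes "integrable \<rho> f" "0 < n"
  shows "(\<Sum>l<n. LINT s:{real l * T / real n<..real (Suc l) * T / real n}|\<nu>. f s) = (\<integral>s. f s \<partial>\<rho>)"
  using sum_partition_set_integral[OF assms(2) T_pos sets_\<nu> \<nu>_null] assms(1)
  by (simp add: set_integrable_\<rho> set_integral_\<rho>)

text \<open>
  On the cell \<open>(t\<^sub>l, t\<^sub>l\<^sub>+\<^sub>1]\<close> the Riemann sum replaces \<open>\<psi>(s)\<close> by \<open>\<psi>(t\<^sub>l)\<close>, at a distance of at most \<open>e\<close>.
\<close>
lemma riemann_sum_inner_error:
  assumes n: "0 < n" and \<psi>: "square_integrable \<rho> \<psi>" and h: "square_integrable \<rho> h"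
    and osc: "\<And>l s. l < n \<Longrightarrow> s \<in> {real l * T / real n<..real (Suc l) * T / real n} \<Longrightarrow>
       \<bar>\<psi> (real l * T / real n) - \<psi> s\<bar> \<le> e"
  shows "\<bar>(\<Sum>l<n. \<psi> (real l * T / real n) *
       (LINT s:{real l * T / real n<..real (Suc l) * T / real n}|\<nu>. h s)) - L2_inner \<rho> h \<psi>\<bar>
    \<le> e * (\<integral>s. \<bar>h s\<bar> \<partial>\<rho>)"
proof -
  let ?t = "\<lambda>l. real l * T / real n"
  let ?I = "\<lambda>l. {?t l<..?t (Suc l)}"
  interpret finite_measure \<rho> by (rule finite_\<rho>)
  have hi: "integrable \<rho> h"
    by (rule square_integrable_imp_integrable[OF h])
  have p: "integrable \<rho> (\<lambda>s. h s * \<psi> s)"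
    by (rule integrable_mult_square_integrable[OF h \<psi>])
  have split: "(\<Sum>l<n. \<psi> (?t l) * (LINT s:?I l|\<nu>. h s)) - L2_inner \<rho> h \<psi>
      = (\<Sum>l<n. LINT s:?I l|\<nu>. \<psi> (?t l) * h s - h s * \<psi> s)"
  proof -
    have "(LINT s:?I l|\<nu>. \<psi> (?t l) * h s - h s * \<psi> s)
        = \<psi> (?t l) * (LINT s:?I l|\<nu>. h s) - (LINT s:?I l|\<nu>. h s * \<psi> s)" if "l < n" for l
      using set_integrable_cell[OF hi n that] set_integrable_cell[OF p n that]
      by (subst set_integral_diff) auto
    then show ?thesis
      using sum_partition_\<rho>[OF p n] by (simp add: sum_subtractf L2_inner_def)
  qed
  have "\<bar>\<Sum>l<n. LINT s:?I l|\<nu>. \<psi> (?t l) * h s - h s * \<psi> s\<bar> \<le> (\<Sum>l<n. LINT s:?I l|\<nu>. e * \<bar>h s\<bar>)"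
  proof (rule order_trans[OF sum_abs], rule sum_mono)
    fix l assume "l \<in> {..<n}"
    then have l: "l < n" by simp
    have i: "set_integrable \<nu> (?I l) (\<lambda>s. \<psi> (?t l) * h s - h s * \<psi> s)"
      using set_integrable_cell[OF hi n l] set_integrable_cell[OF p n l]
      by (intro set_integral_diff(1)) auto
    have "\<bar>LINT s:?I l|\<nu>. \<psi> (?t l) * h s - h s * \<psi> s\<bar>
       \<le> (LINT s:?I l|\<nu>. \<bar>\<psi> (?t l) * h s - h s * \<psi> s\<bar>)"
      using set_integral_norm_bound[OF i] by simp
    also have "\<dots> \<le> (LINT s:?I l|\<nu>. e * \<bar>h s\<bar>)"
    proof (rule set_integral_mono)
      show "set_integrable \<nu> (?I l) (\<lambda>s. \<bar>\<psi> (?t l) * h s - h s * \<psi> s\<bar>)"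
        using set_integrable_abs[OF i] by simp
      show "set_integrable \<nu> (?I l) (\<lambda>s. e * \<bar>h s\<bar>)"
        by (intro set_integrable_mult_right set_integrable_abs set_integrable_cell hi n l)
      fix s assume "s \<in> ?I l"
      then have "\<bar>\<psi> (?t l) - \<psi> s\<bar> * \<bar>h s\<bar> \<le> e * \<bar>h s\<bar>"
        by (intro mult_right_mono osc l) auto
      then show "\<bar>\<psi> (?t l) * h s - h s * \<psi> s\<bar> \<le> e * \<bar>h s\<bar>"
        by (simp add: abs_mult[symmetric] algebra_simps)
    qed
    finally show "\<bar>LINT s:?I l|\<nu>. \<psi> (?t l) * h s - h s * \<psi> s\<bar> \<le> (LINT s:?I l|\<nu>. e * \<bar>h s\<bar>)" .
  qed
  also have "\<dots> = (\<integral>s. e * \<bar>h s\<bar> \<partial>\<rho>)"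
    by (intro sum_partition_\<rho> integrable_mult_right integrable_abs hi n)
  also have "\<dots> = e * (\<integral>s. \<bar>h s\<bar> \<partial>\<rho>)" by simp
  finally show ?thesis unfolding split .
qed

text \<open>
  From \<open>\<psi>(t\<^sub>l)\<^sup>2 \<le> 2 \<psi>(s)\<^sup>2 + 2 (\<psi>(t\<^sub>l) - \<psi>(s))\<^sup>2\<close>, integrated over the cell of \<open>t\<^sub>l\<close>. The factor \<open>2\<close> avoids
  any bound on the supremum of \<open>\<bar>\<psi>\<bar>\<close>, which orthonormality does not provide.
\<close>
lemma riemann_sum_square_le:
  assumes n: "0 < n" and \<psi>: "square_integrable \<rho> \<psi>"
    and osc: "\<And>l s. l < n \<Longrightarrow> s \<in> {real l * T / real n<..real (Suc l) * T / real n} \<Longrightarrow>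
       \<bar>\<psi> (real l * T / real n) - \<psi> s\<bar> \<le> e"
  shows "(\<Sum>l<n. (\<psi> (real l * T / real n))\<^sup>2 * (V (real (Suc l) * T / real n) - V (real l * T / real n)))
    \<le> 2 * (\<integral>s. (\<psi> s)\<^sup>2 \<partial>\<rho>) + 2 * e\<^sup>2 * V T"
proof -
  let ?t = "\<lambda>l. real l * T / real n"
  let ?I = "\<lambda>l. {?t l<..?t (Suc l)}"
  interpret finite_measure \<rho> by (rule finite_\<rho>)
  have \<psi>2: "integrable \<rho> (\<lambda>s. (\<psi> s)\<^sup>2)" using \<psi> by (simp add: square_integrable_def)
  have "(\<Sum>l<n. (\<psi> (?t l))\<^sup>2 * (V (?t (Suc l)) - V (?t l)))
      \<le> (\<Sum>l<n. LINT s:?I l|\<nu>. 2 * (\<psi> s)\<^sup>2 + 2 * e\<^sup>2 * 1)"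
  proof (rule sum_mono)
    fix l assume "l \<in> {..<n}"
    then have l: "l < n" by simp
    have "V (?t (Suc l)) - V (?t l) = (LINT s:?I l|\<nu>. 1)"
      using V_diff[of "?t l" "?t (Suc l)"] partition_point[OF n, of l]
        partition_point[OF n, of "Suc l"] partition_step[OF n, of l] l by simp
    then have "(\<psi> (?t l))\<^sup>2 * (V (?t (Suc l)) - V (?t l)) = (LINT s:?I l|\<nu>. (\<psi> (?t l))\<^sup>2 * 1)"
      by (simp only: set_integral_mult_right)
    also have "\<dots> \<le> (LINT s:?I l|\<nu>. 2 * (\<psi> s)\<^sup>2 + 2 * e\<^sup>2 * 1)"
    proof (rule set_integral_mono)
      show "set_integrable \<nu> (?I l) (\<lambda>_. (\<psi> (?t l))\<^sup>2 * 1)"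
        by (intro set_integrable_cell n l) simp
      show "set_integrable \<nu> (?I l) (\<lambda>s. 2 * (\<psi> s)\<^sup>2 + 2 * e\<^sup>2 * 1)"
        by (intro set_integrable_cell n l) (use \<psi>2 in simp)
      fix s assume "s \<in> ?I l"
      then have "(\<psi> (?t l) - \<psi> s)\<^sup>2 \<le> e\<^sup>2"
        using osc[OF l, of s] by (metis abs_ge_zero order_trans power2_abs power_mono)
      moreover have "(\<psi> (?t l))\<^sup>2 \<le> 2 * (\<psi> s)\<^sup>2 + 2 * (\<psi> (?t l) - \<psi> s)\<^sup>2"
        using zero_le_power2[of "2 * \<psi> s - \<psi> (?t l)"] by (simp add: power2_eq_square algebra_simps)
      ultimately show "(\<psi> (?t l))\<^sup>2 * 1 \<le> 2 * (\<psi> s)\<^sup>2 + 2 * e\<^sup>2 * 1" by simp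
    qed
    finally show "(\<psi> (?t l))\<^sup>2 * (V (?t (Suc l)) - V (?t l))
       \<le> (LINT s:?I l|\<nu>. 2 * (\<psi> s)\<^sup>2 + 2 * e\<^sup>2 * 1)" .
  qed
  also have "\<dots> = (\<integral>s. 2 * (\<psi> s)\<^sup>2 + 2 * e\<^sup>2 * 1 \<partial>\<rho>)"
    by (rule sum_partition_\<rho>[OF _ n]) (use \<psi>2 in simp)
  also have "\<dots> = 2 * (\<integral>s. (\<psi> s)\<^sup>2 \<partial>\<rho>) + 2 * e\<^sup>2 * V T"
    unfolding V_T using \<psi>2 by (subst Bochner_Integration.integral_add) auto
  finally show ?thesis .
qed

lemma signal_process_increment:
  assumes J0: "square_integrable \<rho> J0" and st: "0 \<le> s" "s \<le> t" "t \<le> T"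
  shows "signal_process T V J0 X t \<omega> - signal_process T V J0 X s \<omega>
    = (LINT x:{s<..t}|\<nu>. J0 x) + (X t \<omega> - X s \<omega>)"
proof -
  interpret finite_measure \<rho> by (rule finite_\<rho>)
  have "integrable \<rho> J0"
    by (rule square_integrable_imp_integrable[OF J0])
  then have int: "set_integrable \<nu> {0..T} J0" by (simp add: set_integrable_\<rho>)
  have "{0..s} \<union> {s<..t} = {0..t}" using st by auto
  moreover have "(LINT x:{0..s} \<union> {s<..t}|\<nu>. J0 x)
      = (LINT x:{0..s}|\<nu>. J0 x) + (LINT x:{s<..t}|\<nu>. J0 x)"
    by (intro set_integral_Un set_integrable_subset[OF int]) (use st in \<open>auto simp: sets_\<nu>\<close>)
  ultimately show ?thesis by (simp add: signal_process_def)
qed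

text \<open>
  Parseval's identity in \<open>L\<^sup>2(dt)\<close> turns the comparison \<open>dV \<ge> \<delta> dt\<close> into a bound on coefficient
  vectors. It yields both the positive definiteness of the Gram matrix and the bound \<open>1/\<delta>\<close> on the
  coefficients of a normalised function.
\<close>
lemma lincomb_sqnorm_ge:
  fixes \<phi> :: "nat \<Rightarrow> real \<Rightarrow> real"
  assumes cont: "\<And>j. j < m \<Longrightarrow> continuous_on {0..T} (\<phi> j)" and on: "orthonormal_L2 T m \<phi>"
  shows "\<delta> * (\<Sum>j<m. (a j)\<^sup>2) \<le> (\<integral>s. (\<Sum>j<m. a j * \<phi> j s)\<^sup>2 \<partial>\<rho>)"
proof -
  let ?L = "restrict_space lborel {0..T}"
  have L: "(LINT t:{0..T}|lborel. f t) = (\<integral>t. f t \<partial>?L)" for f :: "real \<Rightarrow> real"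
    unfolding set_lebesgue_integral_def by (rule integral_restrict_space[symmetric]) simp
  have sq: "square_integrable ?L (\<phi> j)" if "j < m" for j
  proof -
    have "set_integrable lborel {0..T} (\<lambda>s. (\<phi> j s)\<^sup>2)"
      unfolding set_integrable_def
      by (rule borel_integrable_compact) (auto intro: continuous_intros cont that)
    then have "integrable ?L (\<lambda>s. (\<phi> j s)\<^sup>2)"
      unfolding set_integrable_def by (subst integrable_restrict_space) auto
    moreover have "\<phi> j \<in> borel_measurable (restrict_space borel {0..T})"
      by (rule borel_measurable_continuous_on_restrict[OF cont[OF that]])
    then have "\<phi> j \<in> borel_measurable ?L"
      using measurable_cong_sets[OF sets_restrict_space_cong[OF sets_lborel] refl] by blast
    ultimately show ?thesis by (simp add: square_integrable_def)
  qed
  have "orthonormal_family ?L m \<phi>"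
    unfolding orthonormal_family_def L2_inner_def L[symmetric]
    using on sq by (simp add: orthonormal_L2_def)
  from orthonormal_sqdist[OF this, of "\<lambda>_. 0" a]
  have "(LINT t:{0..T}|lborel. (\<Sum>j<m. a j * \<phi> j t)\<^sup>2) = (\<Sum>j<m. (a j)\<^sup>2)"
    by (simp add: L L2_inner_def square_integrable_def)
  moreover have "continuous_on {0..T} (\<lambda>s. \<Sum>j<m. a j * \<phi> j s)"
    by (intro continuous_intros cont) simp
  ultimately show ?thesis
    using sqnorm_ge_lebesgue[of "\<lambda>s. \<Sum>j<m. a j * \<phi> j s"] by simp
qed

end

section \<open>Martingale increments along a partition\<close>

text \<open>
  The integral against \<open>Z\<close> of the step function equal to \<open>c l\<close> on \<open>(\<tau> l, \<tau> (l + 1)]\<close>.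
\<close>
definition increment_sum ::
  "nat \<Rightarrow> (nat \<Rightarrow> real) \<Rightarrow> (nat \<Rightarrow> real) \<Rightarrow> (real \<Rightarrow> 'a \<Rightarrow> real) \<Rightarrow> 'a \<Rightarrow> real" where
  "increment_sum n \<tau> c Z \<omega> = (\<Sum>l<n. c l * (Z (\<tau> (Suc l)) \<omega> - Z (\<tau> l) \<omega>))"

lemma increment_sum_lincomb:
  "(\<Sum>j<m. a j * increment_sum n \<tau> (c j) Z \<omega>) = increment_sum n \<tau> (\<lambda>l. \<Sum>j<m. a j * c j l) Z \<omega>"
  unfolding increment_sum_def
  by (simp add: sum_distrib_left sum_distrib_right mult.assoc sum.swap[of _ "{..<n}"])

locale square_integrable_martingale = prob_space P
  for P :: "'a measure" and F :: "real \<Rightarrow> 'a measure" and T :: real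
    and M :: "real \<Rightarrow> 'a \<Rightarrow> real" and V :: "real \<Rightarrow> real" +
  assumes filtration_mono: "s \<le> t \<Longrightarrow> sets (F s) \<subseteq> sets (F t)"
    and space_filtration: "space (F t) = space P"
    and subalg: "t \<in> {0..T} \<Longrightarrow> subalgebra P (F t)"
    and mart: "martingale_on P F T M"
    and sq: "t \<in> {0..T} \<Longrightarrow> integrable P (\<lambda>\<omega>. (M t \<omega>)\<^sup>2)"
    and bracket: "martingale_on P F T (\<lambda>t \<omega>. (M t \<omega>)\<^sup>2 - V t)"
begin

lemma measurable_filtration_mono:
  assumes "f \<in> borel_measurable (F s)" "s \<le> t"
  shows "f \<in> borel_measurable (F t)"
  using measurable_mono[of borel borel "F s" "F t"] filtration_mono[OF assms(2)] assms(1)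
  by (auto simp: space_filtration)

lemma M_measurable: "t \<in> {0..T} \<Longrightarrow> M t \<in> borel_measurable (F t)"
  using mart by (auto simp: martingale_on_def adapted_on_def)

lemma M_measurable_P: "t \<in> {0..T} \<Longrightarrow> M t \<in> borel_measurable P"
  using M_measurable measurable_from_subalg[OF subalg] by blast

lemma M_square_integrable: "t \<in> {0..T} \<Longrightarrow> square_integrable P (M t)"
  using M_measurable_P sq by (simp add: square_integrable_def)

text \<open>
  A factor known at time \<open>s\<close> can be taken inside the conditional expectation given the information
  at time \<open>s\<close>.
\<close>
lemma expectation_mult_martingale:
  assumes X: "martingale_on P F T X" and st: "s \<in> {0..T}" "t \<in> {s..T}"
    and Y: "Y \<in> borel_measurable (F s)" and int: "integrable P (\<lambda>\<omega>. Y \<omega> * X t \<omega>)"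
  shows "expectation (\<lambda>\<omega>. Y \<omega> * X t \<omega>) = expectation (\<lambda>\<omega>. Y \<omega> * X s \<omega>)"
proof -
  have t: "t \<in> {0..T}" using st by auto
  have "finite_measure_subalgebra P (F s)"
    by unfold_locales (rule subalg[OF st(1)])
  then interpret S: sigma_finite_subalgebra P "F s"
    by (rule finite_measure_subalgebra_is_sigma_finite)
  have XP: "X u \<in> borel_measurable P" if "u \<in> {0..T}" for u
    using X that measurable_from_subalg[OF subalg]
    by (auto simp: martingale_on_def adapted_on_def)
  note [measurable] = XP[OF t] XP[OF st(1)] measurable_from_subalg[OF subalg[OF st(1)] Y]
  have ae: "AE \<omega> in P. real_cond_exp P (F s) (X t) \<omega> = X s \<omega>"
    using X st by (auto simp: martingale_on_def)
  have "expectation (\<lambda>\<omega>. Y \<omega> * X t \<omega>) = expectation (\<lambda>\<omega>. Y \<omega> * real_cond_exp P (F s) (X t) \<omega>)"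
    using S.real_cond_exp_intg(2)[OF int Y XP[OF t]] by simp
  also have "\<dots> = expectation (\<lambda>\<omega>. Y \<omega> * X s \<omega>)"
    using ae by (intro integral_cong_AE) auto
  finally show ?thesis .
qed

lemma expectation_martingale_const:
  assumes X: "martingale_on P F T X" and "s \<in> {0..T}" "t \<in> {s..T}"
  shows "expectation (X t) = expectation (X s)"
  using expectation_mult_martingale[OF assms, of "\<lambda>_. 1"] X assms(2,3)
  by (auto simp: martingale_on_def)

lemma expectation_mult_increment:
  assumes st: "s \<in> {0..T}" "t \<in> {s..T}"
    and Y: "Y \<in> borel_measurable (F s)" "square_integrable P Y"
  shows "expectation (\<lambda>\<omega>. Y \<omega> * (M t \<omega> - M s \<omega>)) = 0"
proof -
  have t: "t \<in> {0..T}" using st by auto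
  note int = integrable_mult_square_integrable[OF Y(2) M_square_integrable]
  show ?thesis
    using expectation_mult_martingale[OF mart st Y(1) int[OF t]]
    by (simp add: right_diff_distrib int[OF t] int[OF st(1)])
qed

text \<open>
  Orthogonality of \<open>M s\<close> and \<open>M t - M s\<close> reduces the left-hand side to the growth of \<open>E[M\<^sup>2]\<close>, which
  is the growth of \<open>V\<close> because \<open>M\<^sup>2 - V\<close> is a martingale.
\<close>
lemma expectation_increment_square:
  assumes st: "s \<in> {0..T}" "t \<in> {s..T}"
  shows "expectation (\<lambda>\<omega>. (M t \<omega> - M s \<omega>)\<^sup>2) = V t - V s"
proof -
  have t: "t \<in> {0..T}" using st by auto
  have "expectation (\<lambda>\<omega>. (M t \<omega>)\<^sup>2) - V t = expectation (\<lambda>\<omega>. (M s \<omega>)\<^sup>2) - V s"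
    using expectation_martingale_const[OF bracket st] sq[OF t] sq[OF st(1)]
    by (simp add: prob_space)
  moreover have "expectation (\<lambda>\<omega>. M s \<omega> * (M t \<omega> - M s \<omega>)) = 0"
    using st by (intro expectation_mult_increment M_measurable M_square_integrable) auto
  moreover have "expectation (\<lambda>\<omega>. (M t \<omega> - M s \<omega>)\<^sup>2)
    = expectation (\<lambda>\<omega>. (M t \<omega>)\<^sup>2 - (M s \<omega>)\<^sup>2 - 2 * (M s \<omega> * (M t \<omega> - M s \<omega>)))"
    by (intro Bochner_Integration.integral_cong) (auto simp: power2_eq_square algebra_simps)
  moreover have "integrable P (\<lambda>\<omega>. M s \<omega> * (M t \<omega> - M s \<omega>))"
    by (intro integrable_mult_square_integrable square_integrable_diff M_square_integrable t st)
  ultimately show ?thesis using sq[OF t] sq[OF st(1)] by simp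
qed

text \<open>
  The isometry property of the stochastic integral for deterministic step functions. In the
  induction on the number of steps the partial sum is known at the left end of the next increment,
  so the cross term has expectation \<open>0\<close>.
\<close>
lemma martingale_transform_moments:
  fixes \<tau> c :: "nat \<Rightarrow> real"
  assumes \<tau>: "\<And>l. l < n \<Longrightarrow> \<tau> l \<le> \<tau> (Suc l)" "\<And>l. l \<le> n \<Longrightarrow> \<tau> l \<in> {0..T}"
  shows "square_integrable P (increment_sum n \<tau> c M)"
    and "expectation (increment_sum n \<tau> c M) = 0"
    and "expectation (\<lambda>\<omega>. (increment_sum n \<tau> c M \<omega>)\<^sup>2)
      = (\<Sum>l<n. (c l)\<^sup>2 * (V (\<tau> (Suc l)) - V (\<tau> l)))"
proof -
  define S where "S = (\<lambda>k \<omega>. \<Sum>l<k. c l * (M (\<tau> (Suc l)) \<omega> - M (\<tau> l) \<omega>))"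
  have S: "increment_sum n \<tau> c M = S n" by (simp add: S_def increment_sum_def[abs_def])
  have main: "k \<le> n \<Longrightarrow> S k \<in> borel_measurable (F (\<tau> k)) \<and> square_integrable P (S k) \<and>
     expectation (S k) = 0 \<and>
     expectation (\<lambda>\<omega>. (S k \<omega>)\<^sup>2) = (\<Sum>l<k. (c l)\<^sup>2 * (V (\<tau> (Suc l)) - V (\<tau> l)))" for k
  proof (induction k)
    case 0
    then show ?case by (simp add: S_def square_integrable_def)
  next
    case (Suc k)
    let ?D = "\<lambda>\<omega>. M (\<tau> (Suc k)) \<omega> - M (\<tau> k) \<omega>"
    have k: "\<tau> k \<in> {0..T}" and k': "\<tau> (Suc k) \<in> {0..T}" and le: "\<tau> k \<le> \<tau> (Suc k)"
      using \<tau> Suc.prems by auto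
    have st: "\<tau> (Suc k) \<in> {\<tau> k..T}" using le k' by auto
    have IH: "S k \<in> borel_measurable (F (\<tau> k))" "square_integrable P (S k)" "expectation (S k) = 0"
     "expectation (\<lambda>\<omega>. (S k \<omega>)\<^sup>2) = (\<Sum>l<k. (c l)\<^sup>2 * (V (\<tau> (Suc l)) - V (\<tau> l)))"
      using Suc by auto
    have S_Suc: "S (Suc k) = (\<lambda>\<omega>. S k \<omega> + c k * ?D \<omega>)" by (simp add: S_def)
    have D: "square_integrable P ?D" by (intro square_integrable_diff M_square_integrable k k')
    have intD: "integrable P ?D"
      using mart k k' by (auto simp: martingale_on_def)
    have intS: "integrable P (S k)"
      by (rule square_integrable_imp_integrable[OF IH(2)])
    have "expectation ?D = 0"
      using expectation_martingale_const[OF mart k st] mart k k' by (auto simp: martingale_on_def)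
    then have 1: "expectation (S (Suc k)) = 0"
      unfolding S_Suc using IH(3) intD intS by simp
    have "(\<lambda>\<omega>. (S (Suc k) \<omega>)\<^sup>2) = (\<lambda>\<omega>. (S k \<omega>)\<^sup>2 + 2 * c k * (S k \<omega> * ?D \<omega>) + (c k)\<^sup>2 * (?D \<omega>)\<^sup>2)"
      unfolding S_Suc by (auto simp: power2_eq_square algebra_simps)
    then have 2: "expectation (\<lambda>\<omega>. (S (Suc k) \<omega>)\<^sup>2)
       = (\<Sum>l<Suc k. (c l)\<^sup>2 * (V (\<tau> (Suc l)) - V (\<tau> l)))"
      using IH(2,4) D integrable_mult_square_integrable[OF IH(2) D]
        expectation_mult_increment[OF k st IH(1,2)] expectation_increment_square[OF k st]
      by (simp add: square_integrable_def)
    have "S (Suc k) \<in> borel_measurable (F (\<tau> (Suc k)))"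
      unfolding S_Suc
      using measurable_filtration_mono[OF IH(1) le] measurable_filtration_mono[OF M_measurable[OF k] le] M_measurable[OF k']
      by measurable
    moreover have "square_integrable P (S (Suc k))"
      unfolding S_Suc by (intro square_integrable_add square_integrable_scale IH(2) D)
    ultimately show ?case using 1 2 by blast
  qed
  show "square_integrable P (increment_sum n \<tau> c M)"
    and "expectation (increment_sum n \<tau> c M) = 0"
    and "expectation (\<lambda>\<omega>. (increment_sum n \<tau> c M \<omega>)\<^sup>2)
      = (\<Sum>l<n. (c l)\<^sup>2 * (V (\<tau> (Suc l)) - V (\<tau> l)))"
    using main[of n] unfolding S by auto
qed

end

section \<open>Independent copies\<close>

lemma (in prob_space) average_indep_second_moment:
  fixes X :: "nat \<Rightarrow> 'a \<Rightarrow> real"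
  assumes indep: "indep_vars (\<lambda>_. borel) X {..<N}" and N: "0 < N"
    and sq: "\<And>i. i < N \<Longrightarrow> square_integrable M (X i)"
    and mean: "\<And>i. i < N \<Longrightarrow> expectation (X i) = 0"
    and var: "\<And>i. i < N \<Longrightarrow> expectation (\<lambda>\<omega>. (X i \<omega>)\<^sup>2) = v"
  shows "square_integrable M (\<lambda>\<omega>. 1 / real N * (\<Sum>i<N. X i \<omega>))"
    and "expectation (\<lambda>\<omega>. (1 / real N * (\<Sum>i<N. X i \<omega>))\<^sup>2) = v / real N"
proof -
  show "square_integrable M (\<lambda>\<omega>. 1 / real N * (\<Sum>i<N. X i \<omega>))"
    by (intro square_integrable_scale square_integrable_sum sq) simp
  have int: "integrable M (X i)" if "i < N" for i
    by (rule square_integrable_imp_integrable[OF sq[OF that]])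
  have cross: "expectation (\<lambda>\<omega>. X i \<omega> * X j \<omega>) = of_bool (i = j) * v" if "i < N" "j < N" for i j
  proof (cases "i = j")
    case True then show ?thesis using var[OF that(1)] by (simp add: power2_eq_square)
  next
    case False
    have "expectation (\<lambda>\<omega>. \<Prod>k\<in>{i, j}. X k \<omega>) = (\<Prod>k\<in>{i, j}. expectation (X k))"
      by (rule indep_vars_lebesgue_integral[OF _ indep_vars_subset[OF indep]])
        (use that int in auto)
    then show ?thesis using mean that False by simp
  qed
  have "expectation (\<lambda>\<omega>. (\<Sum>i<N. X i \<omega>)\<^sup>2) = expectation (\<lambda>\<omega>. \<Sum>i<N. \<Sum>j<N. X i \<omega> * X j \<omega>)"
    by (simp add: power2_eq_square sum_product)
  also have "\<dots> = (\<Sum>i<N. \<Sum>j<N. expectation (\<lambda>\<omega>. X i \<omega> * X j \<omega>))"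
  proof -
    have prod: "integrable M (\<lambda>\<omega>. X i \<omega> * X j \<omega>)" if "i < N" "j < N" for i j
      by (intro integrable_mult_square_integrable sq that)
    then have "expectation (\<lambda>\<omega>. \<Sum>i<N. \<Sum>j<N. X i \<omega> * X j \<omega>)
        = (\<Sum>i<N. expectation (\<lambda>\<omega>. \<Sum>j<N. X i \<omega> * X j \<omega>))"
      by (intro Bochner_Integration.integral_sum Bochner_Integration.integrable_sum) auto
    also have "\<dots> = (\<Sum>i<N. \<Sum>j<N. expectation (\<lambda>\<omega>. X i \<omega> * X j \<omega>))"
      using prod by (intro sum.cong refl Bochner_Integration.integral_sum) auto
    finally show ?thesis .
  qed
  also have "\<dots> = (\<Sum>i<N. \<Sum>j<N. if j = i then v else 0)"
    by (intro sum.cong) (auto simp: cross)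
  also have "\<dots> = real N * v" by simp
  finally have "expectation (\<lambda>\<omega>. (\<Sum>i<N. X i \<omega>)\<^sup>2) = real N * v" .
  then show "expectation (\<lambda>\<omega>. (1 / real N * (\<Sum>i<N. X i \<omega>))\<^sup>2) = v / real N"
    using N by (simp add: power_divide power2_eq_square[of "real N"])
qed

text \<open>
  The sum depends on a path only through finitely many of its values, so it is a measurable function
  on the product space of paths. Equality of the path laws and independence of the paths therefore
  pass to these sums, even though the copies live on another probability space.
\<close>
lemma independent_copies_increments:
  fixes Y :: "nat \<Rightarrow> real \<Rightarrow> 'b \<Rightarrow> real" and c \<tau> :: "nat \<Rightarrow> real"
  assumes Q: "prob_space Q" and ind: "independent_copies Q T N Y P X"
    and X: "\<And>t. t \<in> {0..T} \<Longrightarrow> X t \<in> borel_measurable P"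
    and \<tau>: "\<And>l. l \<le> n \<Longrightarrow> \<tau> l \<in> {0..T}"
    and sq: "square_integrable P (increment_sum n \<tau> c X)"
  shows "prob_space.indep_vars Q (\<lambda>_. borel) (\<lambda>i. increment_sum n \<tau> c (Y i)) {..<N}"
    and "i < N \<Longrightarrow> square_integrable Q (increment_sum n \<tau> c (Y i))"
    and "i < N \<Longrightarrow> (\<integral>\<omega>. increment_sum n \<tau> c (Y i) \<omega> \<partial>Q) = (\<integral>\<omega>. increment_sum n \<tau> c X \<omega> \<partial>P)"
    and "i < N \<Longrightarrow> (\<integral>\<omega>. (increment_sum n \<tau> c (Y i) \<omega>)\<^sup>2 \<partial>Q) = (\<integral>\<omega>. (increment_sum n \<tau> c X \<omega>)\<^sup>2 \<partial>P)"
proof -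
  interpret Q: prob_space Q by (rule Q)
  define h where "h = (\<lambda>p :: real \<Rightarrow> real. \<Sum>l<n. c l * (p (\<tau> (Suc l)) - p (\<tau> l)))"
  have h_path: "h (path_on T Z \<omega>) = increment_sum n \<tau> c Z \<omega>" for Z :: "real \<Rightarrow> 'c \<Rightarrow> real" and \<omega>
    unfolding h_def increment_sum_def path_on_def using \<tau> by (intro sum.cong) auto
  have "(\<lambda>p :: real \<Rightarrow> real. p (\<tau> l)) \<in> borel_measurable (path_space T)" if "l \<le> n" for l
    by (rule measurable_component_singleton[OF \<tau>[OF that]])
  then have h[measurable]: "h \<in> borel_measurable (path_space T)"
    unfolding h_def
    by (intro borel_measurable_sum borel_measurable_times borel_measurable_diff borel_measurable_const) auto
  have indep: "Q.indep_vars (\<lambda>_. path_space T) (\<lambda>i. path_on T (Y i)) {..<N}"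
    and law: "\<And>i. i < N \<Longrightarrow> distr Q (path_space T) (path_on T (Y i)) = distr P (path_space T) (path_on T X)"
    using ind by (auto simp: independent_copies_def)
  show "Q.indep_vars (\<lambda>_. borel) (\<lambda>i. increment_sum n \<tau> c (Y i)) {..<N}"
    using Q.indep_vars_compose2[OF indep, of "\<lambda>_. h" "\<lambda>_. borel"] by (simp add: h_path)
  have pX[measurable]: "path_on T X \<in> measurable P (path_space T)"
    unfolding path_on_def[abs_def] by (rule measurable_restrict) (rule X)
  assume i: "i < N"
  have pY[measurable]: "path_on T (Y i) \<in> measurable Q (path_space T)"
    using indep i by (auto simp: Q.indep_vars_def)
  have transfer: "(\<integral>\<omega>. g (increment_sum n \<tau> c (Y i) \<omega>) \<partial>Q) = (\<integral>\<omega>. g (increment_sum n \<tau> c X \<omega>) \<partial>P)"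
    if [measurable]: "g \<in> borel_measurable borel" for g :: "real \<Rightarrow> real"
  proof -
    have "(\<integral>\<omega>. g (h (path_on T (Y i) \<omega>)) \<partial>Q)
        = (\<integral>p. g (h p) \<partial>distr Q (path_space T) (path_on T (Y i)))"
      by (rule integral_distr[symmetric]) measurable
    also have "\<dots> = (\<integral>p. g (h p) \<partial>distr P (path_space T) (path_on T X))"
      by (simp add: law[OF i])
    also have "\<dots> = (\<integral>\<omega>. g (h (path_on T X \<omega>)) \<partial>P)"
      by (rule integral_distr) measurable
    finally show ?thesis by (simp add: h_path)
  qed
  show "(\<integral>\<omega>. increment_sum n \<tau> c (Y i) \<omega> \<partial>Q) = (\<integral>\<omega>. increment_sum n \<tau> c X \<omega> \<partial>P)" using transfer[of "\<lambda>x. x"] by simp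
  show "(\<integral>\<omega>. (increment_sum n \<tau> c (Y i) \<omega>)\<^sup>2 \<partial>Q) = (\<integral>\<omega>. (increment_sum n \<tau> c X \<omega>)\<^sup>2 \<partial>P)" using transfer[of "\<lambda>x. x\<^sup>2"] by simp
  have "integrable P (\<lambda>\<omega>. (h (path_on T X \<omega>))\<^sup>2)"
    using sq by (simp add: square_integrable_def h_path)
  then have "integrable (distr P (path_space T) (path_on T X)) (\<lambda>p. (h p)\<^sup>2)"
    by (subst integrable_distr_eq) measurable
  then have "integrable (distr Q (path_space T) (path_on T (Y i))) (\<lambda>p. (h p)\<^sup>2)"
    by (simp add: law[OF i])
  then have "integrable Q (\<lambda>\<omega>. (h (path_on T (Y i) \<omega>))\<^sup>2)"
    by (subst (asm) integrable_distr_eq) measurable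
  moreover have "(\<lambda>\<omega>. h (path_on T (Y i) \<omega>)) \<in> borel_measurable Q" by measurable
  ultimately show "square_integrable Q (increment_sum n \<tau> c (Y i))"
    by (simp add: square_integrable_def h_path)
qed

lemma (in square_integrable_martingale) independent_copies_noise:
  fixes Y :: "nat \<Rightarrow> real \<Rightarrow> 'b \<Rightarrow> real" and c \<tau> :: "nat \<Rightarrow> real"
  assumes Q: "prob_space Q" and ind: "independent_copies Q T N Y P M" and N: "0 < N"
    and \<tau>: "\<And>l. l < n \<Longrightarrow> \<tau> l \<le> \<tau> (Suc l)" "\<And>l. l \<le> n \<Longrightarrow> \<tau> l \<in> {0..T}"
  shows "square_integrable Q (\<lambda>\<omega>. 1 / real N * (\<Sum>i<N. increment_sum n \<tau> c (Y i) \<omega>))"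
    and "(\<integral>\<omega>. (1 / real N * (\<Sum>i<N. increment_sum n \<tau> c (Y i) \<omega>))\<^sup>2 \<partial>Q)
      = (\<Sum>l<n. (c l)\<^sup>2 * (V (\<tau> (Suc l)) - V (\<tau> l))) / real N"
proof -
  interpret Q: prob_space Q by (rule Q)
  note mom = martingale_transform_moments[of n \<tau> c, OF \<tau>]
  note copies = independent_copies_increments[OF Q ind M_measurable_P \<tau>(2) mom(1)]
  show "square_integrable Q (\<lambda>\<omega>. 1 / real N * (\<Sum>i<N. increment_sum n \<tau> c (Y i) \<omega>))"
    by (rule Q.average_indep_second_moment(1)[OF copies(1) N])
      (use copies mom in auto)
  show "(\<integral>\<omega>. (1 / real N * (\<Sum>i<N. increment_sum n \<tau> c (Y i) \<omega>))\<^sup>2 \<partial>Q)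
      = (\<Sum>l<n. (c l)\<^sup>2 * (V (\<tau> (Suc l)) - V (\<tau> l))) / real N"
    by (rule Q.average_indep_second_moment(2)[OF copies(1) N])
      (use copies mom in auto)
qed

section \<open>The risk of the discrete-time estimator\<close>

context bracket_density
begin

lemma lincomb_sqnorm_pos:
  assumes "\<And>j. j < m \<Longrightarrow> continuous_on {0..T} (\<phi> j)" "orthonormal_L2 T m \<phi>" "\<exists>j<m. a j \<noteq> 0"
  shows "0 < (\<integral>s. (\<Sum>j<m. a j * \<phi> j s)\<^sup>2 \<partial>\<rho>)"
proof -
  have "0 < (\<Sum>j<m. (a j)\<^sup>2)"
    using assms(3) by (auto intro: sum_pos2)
  then have "0 < \<delta> * (\<Sum>j<m. (a j)\<^sup>2)" using \<delta>_pos by simp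
  then show ?thesis using lincomb_sqnorm_ge[OF assms(1,2), of a] by linarith
qed

text \<open>
  The normal equations give the inner products with the \<open>\<phi>\<^sub>j\<close>. Both sides are linear in \<open>\<psi>\<close>, so the
  same formula holds on the whole span.
\<close>
lemma L2_inner_J_hat:
  fixes \<phi> :: "nat \<Rightarrow> real \<Rightarrow> real" and a :: "nat \<Rightarrow> real"
  assumes cont: "\<And>j. j < m \<Longrightarrow> continuous_on {0..T} (\<phi> j)" and on: "orthonormal_L2 T m \<phi>"
    and \<psi>: "\<psi> = (\<lambda>t. \<Sum>j<m. a j * \<phi> j t)"
  shows "L2_inner \<rho> (J_hat T V \<phi> Z m N n \<omega>) \<psi>
    = 1 / real N * (\<Sum>i<N. increment_sum n (\<lambda>l. real l * T / real n) (\<lambda>l. \<psi> (real l * T / real n)) (Z i) \<omega>)"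
proof -
  let ?\<tau> = "\<lambda>l. real l * T / real n"
  let ?J = "J_hat T V \<phi> Z m N n \<omega>" and ?z = "z_vec T \<phi> Z m N n \<omega>"
  have sq: "square_integrable \<rho> (\<phi> j)" if "j < m" for j
    by (rule continuous_square_integrable[OF cont[OF that]])
  have Psi: "Psi_mat T V \<phi> m = Matrix.mat m m (\<lambda>(j, k). L2_inner \<rho> (\<phi> j) (\<phi> k))"
    by (simp add: Psi_mat_def L2_inner_def set_integral_\<rho>)
  have J: "?J = (\<lambda>t. \<Sum>j<m. vec_index (theta_hat T V \<phi> Z m N n \<omega>) j * \<phi> j t)"
    by (simp add: J_hat_def[abs_def])
  have sqJ: "square_integrable \<rho> ?J"
    unfolding J by (rule square_integrable_lincomb) (rule sq)
  have normal: "L2_inner \<rho> ?J (\<phi> j) = vec_index ?z j" if "j < m" for j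
    unfolding J theta_hat_def Psi
    by (rule gram_matrix_inverse_solves[OF sq lincomb_sqnorm_pos[OF cont on] _ that])
      (auto simp: z_vec_def)
  have "L2_inner \<rho> ?J \<psi> = (\<Sum>j<m. a j * L2_inner \<rho> ?J (\<phi> j))"
    unfolding \<psi> using L2_inner_lincomb[where f = \<phi> and m = m and a = a, OF sq sqJ]
    by (simp add: L2_inner_commute[of \<rho> ?J])
  also have "\<dots> = (\<Sum>j<m. a j * (1 / real N * (\<Sum>i<N. increment_sum n ?\<tau> (\<lambda>l. \<phi> j (?\<tau> l)) (Z i) \<omega>)))"
    by (intro sum.cong refl) (simp add: normal z_vec_def increment_sum_def)
  also have "\<dots> = 1 / real N * (\<Sum>j<m. \<Sum>i<N. a j * increment_sum n ?\<tau> (\<lambda>l. \<phi> j (?\<tau> l)) (Z i) \<omega>)"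
    by (simp add: sum_distrib_left mult.left_commute)
  also have "(\<Sum>j<m. \<Sum>i<N. a j * increment_sum n ?\<tau> (\<lambda>l. \<phi> j (?\<tau> l)) (Z i) \<omega>)
     = (\<Sum>i<N. \<Sum>j<m. a j * increment_sum n ?\<tau> (\<lambda>l. \<phi> j (?\<tau> l)) (Z i) \<omega>)"
    by (rule sum.swap)
  finally show ?thesis by (simp add: increment_sum_lincomb \<psi>)
qed

lemma average_signal_increment_sum:
  assumes J0: "square_integrable \<rho> J0" and "0 < N" "0 < n"
  shows "1 / real N * (\<Sum>i<N. increment_sum n (\<lambda>l. real l * T / real n) c (signal_process T V J0 (X i)) \<omega>)
    = (\<Sum>l<n. c l * (LINT s:{real l * T / real n<..real (Suc l) * T / real n}|\<nu>. J0 s))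
      + 1 / real N * (\<Sum>i<N. increment_sum n (\<lambda>l. real l * T / real n) c (X i) \<omega>)"
proof -
  let ?\<tau> = "\<lambda>l. real l * T / real n"
  let ?D = "\<Sum>l<n. c l * (LINT s:{?\<tau> l<..?\<tau> (Suc l)}|\<nu>. J0 s)"
  have "increment_sum n ?\<tau> c (signal_process T V J0 (X i)) \<omega> = ?D + increment_sum n ?\<tau> c (X i) \<omega>" for i
  proof -
    have "signal_process T V J0 (X i) (?\<tau> (Suc l)) \<omega> - signal_process T V J0 (X i) (?\<tau> l) \<omega>
       = (LINT s:{?\<tau> l<..?\<tau> (Suc l)}|\<nu>. J0 s) + (X i (?\<tau> (Suc l)) \<omega> - X i (?\<tau> l) \<omega>)"
      if "l < n" for l
      using partition_point[OF assms(3), of l] partition_point[OF assms(3), of "Suc l"] that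
        partition_step[OF assms(3), of l]
      by (intro signal_process_increment J0) auto
    then show ?thesis
      unfolding increment_sum_def sum.distrib[symmetric] distrib_left[symmetric]
      by (intro sum.cong) auto
  qed
  then show ?thesis using assms(2) by (simp add: sum.distrib distrib_left)
qed

text \<open>
  By the Cauchy--Schwarz inequality the derivative of the combination is at most \<open>sqrt (A * R)\<close> in
  absolute value.
\<close>
lemma lincomb_oscillation:
  fixes \<phi> \<phi>' :: "nat \<Rightarrow> real \<Rightarrow> real" and a :: "nat \<Rightarrow> real"
  assumes deriv: "\<And>j t. j < m \<Longrightarrow> t \<in> {0..T} \<Longrightarrow> (\<phi> j has_real_derivative \<phi>' j t) (at t within {0..T})"
    and R: "\<And>t. t \<in> {0..T} \<Longrightarrow> (\<Sum>j<m. (\<phi>' j t)\<^sup>2) \<le> R"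
    and A: "(\<Sum>j<m. (a j)\<^sup>2) \<le> A" "0 \<le> A"
    and st: "s \<in> {0..T}" "t \<in> {0..T}" "\<bar>s - t\<bar> \<le> h"
  shows "\<bar>(\<Sum>j<m. a j * \<phi> j s) - (\<Sum>j<m. a j * \<phi> j t)\<bar> \<le> sqrt (A * R) * h"
proof -
  have "norm ((\<Sum>j<m. a j * \<phi> j s) - (\<Sum>j<m. a j * \<phi> j t)) \<le> sqrt (A * R) * norm (s - t)"
  proof (rule field_differentiable_bound[of "{0..T}" _ "\<lambda>x. \<Sum>j<m. a j * \<phi>' j x"])
    fix x assume x: "x \<in> {0..T}"
    show "((\<lambda>t. \<Sum>j<m. a j * \<phi> j t) has_real_derivative (\<Sum>j<m. a j * \<phi>' j x)) (at x within {0..T})"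
      by (intro DERIV_sum DERIV_cmult deriv x) simp
    have "(\<Sum>j<m. a j * \<phi>' j x)\<^sup>2 \<le> (\<Sum>j<m. (a j)\<^sup>2) * (\<Sum>j<m. (\<phi>' j x)\<^sup>2)"
      by (rule Cauchy_Schwarz_ineq_sum)
    also have "\<dots> \<le> A * R"
      by (intro mult_mono A R x sum_nonneg) auto
    finally show "norm (\<Sum>j<m. a j * \<phi>' j x) \<le> sqrt (A * R)"
      using real_sqrt_le_mono real_sqrt_abs by fastforce
  qed (use st in auto)
  also have "\<dots> \<le> sqrt (A * R) * h"
    using st R[OF st(1)] A(2) order_trans[OF sum_nonneg[of "{..<m}" "\<lambda>j. (\<phi>' j s)\<^sup>2"] R[OF st(1)]]
    by (intro mult_left_mono) auto
  finally show ?thesis by simp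
qed

text \<open>
  The quantitative estimate. The process driving the observations enters only through the second
  moments of its averaged increment sums. The number \<open>\<eta>\<close> is the square of the bound on the
  oscillation of the orthonormal functions over one step of the grid, and \<open>K\<close> is the \<open>L\<^sup>1\<close> norm of
  \<open>J0\<close>.
\<close>
lemma risk_bound:
  fixes \<phi> \<phi>' :: "nat \<Rightarrow> real \<Rightarrow> real" and X :: "nat \<Rightarrow> real \<Rightarrow> 'b \<Rightarrow> real"
  assumes Q: "prob_space Q" and J0: "square_integrable \<rho> J0" and pos: "0 < N" "0 < n"
    and cont: "\<And>j. j < m \<Longrightarrow> continuous_on {0..T} (\<phi> j)"
    and deriv: "\<And>j t. j < m \<Longrightarrow> t \<in> {0..T} \<Longrightarrow> (\<phi> j has_real_derivative \<phi>' j t) (at t within {0..T})"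
    and on: "orthonormal_L2 T m \<phi>"
    and R: "\<And>t. t \<in> {0..T} \<Longrightarrow> (\<Sum>j<m. (\<phi>' j t)\<^sup>2) \<le> R"
    and noise_sq: "\<And>c. square_integrable Q (\<lambda>\<omega>. 1 / real N *
        (\<Sum>i<N. increment_sum n (\<lambda>l. real l * T / real n) c (X i) \<omega>))"
    and noise_var: "\<And>c. (\<integral>\<omega>. (1 / real N *
        (\<Sum>i<N. increment_sum n (\<lambda>l. real l * T / real n) c (X i) \<omega>))\<^sup>2 \<partial>Q)
        = (\<Sum>l<n. (c l)\<^sup>2 * (V (real (Suc l) * T / real n) - V (real l * T / real n))) / real N"
  defines "\<eta> \<equiv> T\<^sup>2 * R / (\<delta> * (real n)\<^sup>2)" and "K \<equiv> \<integral>s. \<bar>J0 s\<bar> \<partial>\<rho>"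
  shows "(\<integral>\<^sup>+\<omega>. ennreal (bracket_sqnorm T V
        (\<lambda>t. J_hat T V \<phi> (\<lambda>i. signal_process T V J0 (X i)) m N n \<omega> t - J0 t)) \<partial>Q)
    \<le> ennreal (LEAST x. x \<in> (\<lambda>J. bracket_sqnorm T V (\<lambda>t. J t - J0 t)) ` fun_span m \<phi>)
      + ennreal (real m * (2 * \<eta> * K\<^sup>2))
      + ennreal (real m * (2 * ((2 + 2 * \<eta> * V T) / real N)))"
proof -
  let ?\<tau> = "\<lambda>l. real l * T / real n"
  let ?J = "J_hat T V \<phi> (\<lambda>i. signal_process T V J0 (X i)) m N n"
  let ?min = "LEAST x. x \<in> (\<lambda>J. bracket_sqnorm T V (\<lambda>t. J t - J0 t)) ` fun_span m \<phi>"
  have sq: "square_integrable \<rho> (\<phi> j)" if "j < m" for j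
    by (rule continuous_square_integrable[OF cont[OF that]])
  obtain \<psi> where ons: "orthonormal_family \<rho> m \<psi>" and span: "fun_span m \<psi> = fun_span m \<phi>"
    using gram_schmidt_functions[OF sq lincomb_sqnorm_pos[OF cont on]] by auto
  have "\<forall>k. \<exists>a. k < m \<longrightarrow> \<psi> k = (\<lambda>t. \<Sum>j<m. a j * \<phi> j t)"
    using fun_span_base[of _ m \<psi>] unfolding span by (auto elim: fun_spanE)
  then obtain a where a: "\<And>k. k < m \<Longrightarrow> \<psi> k = (\<lambda>t. \<Sum>j<m. a k j * \<phi> j t)" by metis
  have sq\<psi>: "square_integrable \<rho> (\<psi> k)" and norm\<psi>: "(\<integral>s. (\<psi> k s)\<^sup>2 \<partial>\<rho>) = 1" if "k < m" for k
    using ons that by (auto simp: orthonormal_family_def L2_inner_self[symmetric])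
  have A: "(\<Sum>j<m. (a k j)\<^sup>2) \<le> 1 / \<delta>" if "k < m" for k
    using lincomb_sqnorm_ge[OF cont on, of "a k"] norm\<psi>[OF that] \<delta>_pos
    by (simp add: a[OF that] field_simps)
  have R0: "0 \<le> R"
    using R[of 0] T_pos sum_nonneg[of "{..<m}" "\<lambda>j. (\<phi>' j 0)\<^sup>2"] by force
  define e where "e = sqrt (1 / \<delta> * R) * (T / real n)"
  have e2: "e\<^sup>2 = \<eta>"
    unfolding e_def \<eta>_def using R0 \<delta>_pos by (simp add: power_mult_distrib power_divide field_simps)
  have osc: "\<bar>\<psi> k (?\<tau> l) - \<psi> k s\<bar> \<le> e" if "k < m" "l < n" "s \<in> {?\<tau> l<..?\<tau> (Suc l)}" for k l s
    unfolding a[OF that(1)] e_def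
  proof (rule lincomb_oscillation[OF deriv R A[OF that(1)]])
    show "?\<tau> l \<in> {0..T}" using partition_point pos that by simp
    show "s \<in> {0..T}" using partition_cell_subset[of n l] pos that by blast
    have "?\<tau> (Suc l) - ?\<tau> l = T / real n" by (simp add: algebra_simps add_divide_distrib)
    then show "\<bar>?\<tau> l - s\<bar> \<le> T / real n" using that(3) by auto
  qed (use \<delta>_pos in auto)
  \<comment> \<open>discretisation bias and averaged noise of the \<open>k\<close>-th coefficient\<close>
  define \<beta> where "\<beta> = (\<lambda>k. (\<Sum>l<n. \<psi> k (?\<tau> l) * (LINT s:{?\<tau> l<..?\<tau> (Suc l)}|\<nu>. J0 s)) - L2_inner \<rho> J0 (\<psi> k))"
  define Y where "Y = (\<lambda>k \<omega>. 1 / real N * (\<Sum>i<N. increment_sum n ?\<tau> (\<lambda>l. \<psi> k (?\<tau> l)) (X i) \<omega>))"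
  have \<beta>: "(\<beta> k)\<^sup>2 \<le> \<eta> * K\<^sup>2" if "k < m" for k
  proof -
    have "\<bar>\<beta> k\<bar> \<le> e * K"
      unfolding \<beta>_def K_def
      by (rule riemann_sum_inner_error[OF pos(2) sq\<psi>[OF that] J0]) (rule osc[OF that])
    then have "\<bar>\<beta> k\<bar>\<^sup>2 \<le> (e * K)\<^sup>2" by (intro power_mono) auto
    then show ?thesis by (simp add: power_mult_distrib e2)
  qed
  have sqY: "square_integrable Q (Y k)" for k unfolding Y_def by (rule noise_sq)
  have EY: "(\<integral>\<omega>. (Y k \<omega>)\<^sup>2 \<partial>Q) \<le> (2 + 2 * \<eta> * V T) / real N" if "k < m" for k
  proof -
    have "(\<Sum>l<n. (\<psi> k (?\<tau> l))\<^sup>2 * (V (?\<tau> (Suc l)) - V (?\<tau> l))) \<le> 2 * (\<integral>s. (\<psi> k s)\<^sup>2 \<partial>\<rho>) + 2 * e\<^sup>2 * V T"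
      by (rule riemann_sum_square_le[OF pos(2) sq\<psi>[OF that]]) (rule osc[OF that])
    then show ?thesis
      unfolding Y_def noise_var by (intro divide_right_mono) (auto simp: norm\<psi>[OF that] e2)
  qed
  have J_span: "?J \<omega> \<in> fun_span m \<phi>" for \<omega>
    by (rule fun_spanI) (simp add: J_hat_def[abs_def])
  have coef: "L2_inner \<rho> (?J \<omega>) (\<psi> k) - L2_inner \<rho> J0 (\<psi> k) = \<beta> k + Y k \<omega>" if "k < m" for k \<omega>
  proof -
    have "L2_inner \<rho> (?J \<omega>) (\<psi> k) = 1 / real N * (\<Sum>i<N. increment_sum n ?\<tau> (\<lambda>l. \<psi> k (?\<tau> l))
        (signal_process T V J0 (X i)) \<omega>)"
      by (rule L2_inner_J_hat[OF cont on a[OF that]])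
    then show ?thesis
      unfolding average_signal_increment_sum[OF J0 pos] \<beta>_def Y_def by linarith
  qed
  have path: "bracket_sqnorm T V (\<lambda>t. ?J \<omega> t - J0 t) = ?min + (\<Sum>k<m. (\<beta> k + Y k \<omega>)\<^sup>2)" for \<omega>
    unfolding bracket_sqnorm_eq sqdist_eq_least_plus[OF ons span J0 J_span]
    by (simp add: coef)
  have min0: "0 \<le> ?min"
    unfolding bracket_sqnorm_eq by (rule least_sqdist_nonneg[OF ons span J0])
  have "ennreal (bracket_sqnorm T V (\<lambda>t. ?J \<omega> t - J0 t))
     \<le> ennreal ?min + (ennreal (\<Sum>k<m. 2 * (\<beta> k)\<^sup>2) + ennreal (\<Sum>k<m. 2 * (Y k \<omega>)\<^sup>2))" for \<omega>
  proof -
    have "(\<beta> k + Y k \<omega>)\<^sup>2 \<le> 2 * (\<beta> k)\<^sup>2 + 2 * (Y k \<omega>)\<^sup>2" for k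
      using zero_le_power2[of "\<beta> k - Y k \<omega>"] by (simp add: power2_eq_square algebra_simps)
    then have "(\<Sum>k<m. (\<beta> k + Y k \<omega>)\<^sup>2) \<le> (\<Sum>k<m. 2 * (\<beta> k)\<^sup>2) + (\<Sum>k<m. 2 * (Y k \<omega>)\<^sup>2)"
      by (simp add: sum.distrib[symmetric] sum_mono)
    then have "ennreal (bracket_sqnorm T V (\<lambda>t. ?J \<omega> t - J0 t))
      \<le> ennreal (?min + ((\<Sum>k<m. 2 * (\<beta> k)\<^sup>2) + (\<Sum>k<m. 2 * (Y k \<omega>)\<^sup>2)))"
      unfolding path by (intro ennreal_leI) simp
    also have "\<dots> \<le> ennreal ?min + ennreal ((\<Sum>k<m. 2 * (\<beta> k)\<^sup>2) + (\<Sum>k<m. 2 * (Y k \<omega>)\<^sup>2))"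
      by (simp add: min0 ennreal_plus sum_nonneg)
    finally show ?thesis by (simp add: ennreal_plus sum_nonneg)
  qed
  then have "(\<integral>\<^sup>+\<omega>. ennreal (bracket_sqnorm T V (\<lambda>t. ?J \<omega> t - J0 t)) \<partial>Q)
     \<le> (\<integral>\<^sup>+\<omega>. ennreal ?min + (ennreal (\<Sum>k<m. 2 * (\<beta> k)\<^sup>2) + ennreal (\<Sum>k<m. 2 * (Y k \<omega>)\<^sup>2)) \<partial>Q)"
    by (intro nn_integral_mono)
  also have "\<dots> = ennreal ?min + (ennreal (\<Sum>k<m. 2 * (\<beta> k)\<^sup>2)
      + (\<integral>\<^sup>+\<omega>. ennreal (\<Sum>k<m. 2 * (Y k \<omega>)\<^sup>2) \<partial>Q))"
  proof -
    note [measurable] = square_integrable_measurable[OF sqY]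
    show ?thesis by (simp add: nn_integral_add prob_space.emeasure_space_1[OF Q])
  qed
  also have "(\<integral>\<^sup>+\<omega>. ennreal (\<Sum>k<m. 2 * (Y k \<omega>)\<^sup>2) \<partial>Q) = ennreal (\<integral>\<omega>. (\<Sum>k<m. 2 * (Y k \<omega>)\<^sup>2) \<partial>Q)"
    using sqY by (intro nn_integral_eq_integral Bochner_Integration.integrable_sum integrable_mult_right)
      (auto simp: square_integrable_def sum_nonneg)
  also have "(\<integral>\<omega>. (\<Sum>k<m. 2 * (Y k \<omega>)\<^sup>2) \<partial>Q) = (\<Sum>k<m. 2 * (\<integral>\<omega>. (Y k \<omega>)\<^sup>2 \<partial>Q))"
    using sqY by (subst Bochner_Integration.integral_sum) (auto simp: square_integrable_def)
  also have "ennreal ?min + (ennreal (\<Sum>k<m. 2 * (\<beta> k)\<^sup>2)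
      + ennreal (\<Sum>k<m. 2 * (\<integral>\<omega>. (Y k \<omega>)\<^sup>2 \<partial>Q)))
    \<le> ennreal ?min + (ennreal (real m * (2 * \<eta> * K\<^sup>2))
      + ennreal (real m * (2 * ((2 + 2 * \<eta> * V T) / real N))))"
  proof (intro add_left_mono add_mono mult_right_mono ennreal_leI)
    have "(\<Sum>k<m. 2 * (\<beta> k)\<^sup>2) \<le> (\<Sum>k<m. 2 * (\<eta> * K\<^sup>2))"
      using \<beta> by (intro sum_mono mult_left_mono) auto
    then show "(\<Sum>k<m. 2 * (\<beta> k)\<^sup>2) \<le> real m * (2 * \<eta> * K\<^sup>2)" by simp
    have "(\<Sum>k<m. 2 * (\<integral>\<omega>. (Y k \<omega>)\<^sup>2 \<partial>Q)) \<le> (\<Sum>k<m. 2 * ((2 + 2 * \<eta> * V T) / real N))"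
      using EY by (intro sum_mono mult_left_mono) auto
    then show "(\<Sum>k<m. 2 * (\<integral>\<omega>. (Y k \<omega>)\<^sup>2 \<partial>Q)) \<le> real m * (2 * ((2 + 2 * \<eta> * V T) / real N))" by simp
  qed
  finally show ?thesis by (simp add: add.assoc)
qed

end

section \<open>The oracle inequality\<close>

theorem proposition2:
  fixes P :: "'a measure" and F :: "real \<Rightarrow> 'a measure"
    and M :: "real \<Rightarrow> 'a \<Rightarrow> real"
    and T :: real and mu V J0 :: "real \<Rightarrow> real"
  assumes "prob_space P" and "0 < T"
    and "filtration (space P) F" and "\<forall>t\<in>{0..T}. subalgebra P (F t)"
    and "martingale_on P F T M"
    and "continuous_paths_on P T M"
    and "\<forall>t\<in>{0..T}. integrable P (\<lambda>\<omega>. (M t \<omega>)\<^sup>2)"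
    and "AE \<omega> in P. M 0 \<omega> = 0"
    and "\<not> (AE \<omega> in P. \<forall>t\<in>{0..T}. M t \<omega> = 0)"
    and "continuous_on {0<..T} mu" and "\<forall>t\<in>{0<..T}. 0 < mu t"
    and "\<exists>g :: real \<Rightarrow> real. continuous_on {0..T} g \<and> (\<forall>t\<in>{0..T}. 0 \<le> g t) \<and>
           (\<forall>t\<in>{0<..T}. g t = 1 / mu t)"
    and "set_integrable lborel {0<..T} mu"
    and "\<forall>t\<in>{0..T}. V t = (LINT s:{0<..t}|lborel. mu s)"
    and "is_bracket P F T M (\<lambda>t _. V t)"
    and "in_L2 T V J0"
  shows "\<exists>c::real. 0 < c \<and>
    (\<forall>(Q :: 'b measure) (Mi :: nat \<Rightarrow> real \<Rightarrow> 'b \<Rightarrow> real) (N :: nat)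
       (\<phi> :: nat \<Rightarrow> real \<Rightarrow> real) (\<phi>' :: nat \<Rightarrow> real \<Rightarrow> real) (m :: nat) (n :: nat).
       prob_space Q \<longrightarrow> 1 \<le> N \<longrightarrow> independent_copies Q T N Mi P M \<longrightarrow>
       (\<forall>j<N. continuous_on {0..T} (\<phi> j)) \<longrightarrow>
       (\<forall>j<N. \<forall>t\<in>{0..T}. (\<phi> j has_real_derivative \<phi>' j t) (at t within {0..T})) \<longrightarrow>
       orthonormal_L2 T N \<phi> \<longrightarrow>
       1 \<le> m \<longrightarrow> m \<le> N \<longrightarrow> 1 \<le> n \<longrightarrow>
       (\<integral>\<^sup>+\<omega>. ennreal (bracket_sqnorm T V
            (\<lambda>t. J_hat T V \<phi> (\<lambda>i. signal_process T V J0 (Mi i)) m N n \<omega> t - J0 t)) \<partial>Q)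
       \<le> ennreal (2 * (LEAST x. x \<in> (\<lambda>J. bracket_sqnorm T V (\<lambda>t. J t - J0 t)) ` fun_span m \<phi>))
         + ennreal c * (ennreal (real m / real N)
                        + of_nat m * R_sup T \<phi>' m / (of_nat n)\<^sup>2))"
proof -
  obtain g :: "real \<Rightarrow> real" where g: "continuous_on {0..T} g" "\<And>t. t \<in> {0<..T} \<Longrightarrow> g t = 1 / mu t"
    using assms(12) by blast
  have "bounded (g ` {0..T})"
    by (intro compact_imp_bounded compact_continuous_image g) simp
  then obtain b where b: "0 < b" "\<And>t. t \<in> {0..T} \<Longrightarrow> \<bar>g t\<bar> \<le> b"
    unfolding bounded_pos by (metis imageI real_norm_def)
  have mu_ge: "1 / b \<le> mu t" if "t \<in> {0<..T}" for t
  proof -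
    have "1 / mu t \<le> b" using b(2)[of t] g(2)[OF that] that abs_ge_self[of "g t"] by fastforce
    then show ?thesis using assms(11) that b(1) by (simp add: field_simps)
  qed
  interpret B: bracket_density T "1 / b" mu V
    by unfold_locales (use assms b mu_ge in auto)
  interpret prob_space P by (rule assms(1))
  interpret M: square_integrable_martingale P F T M V
  proof unfold_locales
    show "sets (F s) \<subseteq> sets (F t)" if "s \<le> t" for s t
      using filtration.sets_F_mono[OF assms(3) that] by simp
    show "space (F t) = space P" for t by (rule filtration.space_F[OF assms(3)])
    show "martingale_on P F T (\<lambda>t \<omega>. (M t \<omega>)\<^sup>2 - V t)" using assms(15) by (simp add: is_bracket_def)
  qed (use assms in auto)
  have J0: "square_integrable B.\<rho> J0" using assms(16) by (simp add: B.in_L2_iff)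
  define K where "K = (\<integral>s. \<bar>J0 s\<bar> \<partial>B.\<rho>)"
  have V0: "0 \<le> V T" unfolding B.V_T by simp
  \<comment> \<open>The \<open>4\<close> comes from \<open>2 * (2 / N)\<close>; the others, as \<open>1/N \<le> 1\<close>, are \<open>2 \<eta> K\<^sup>2\<close> and \<open>4 \<eta> V T\<close> without \<open>R / n\<^sup>2\<close>, at \<open>\<delta> = 1/b\<close>.\<close>
  define c where "c = 4 + 2 * T\<^sup>2 * K\<^sup>2 * b + 4 * T\<^sup>2 * V T * b"
  have "0 < c" unfolding c_def using b(1) V0 by (intro add_pos_nonneg) auto
  show ?thesis
  proof (intro exI[of _ c] conjI allI impI)
    show "0 < c" by fact
    fix Q :: "'b measure" and Mi :: "nat \<Rightarrow> real \<Rightarrow> 'b \<Rightarrow> real" and N m n :: nat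
      and \<phi> \<phi>' :: "nat \<Rightarrow> real \<Rightarrow> real"
    assume Q: "prob_space Q" and N: "1 \<le> N" and ind: "independent_copies Q T N Mi P M"
      and cont: "\<forall>j<N. continuous_on {0..T} (\<phi> j)"
      and deriv: "\<forall>j<N. \<forall>t\<in>{0..T}. (\<phi> j has_real_derivative \<phi>' j t) (at t within {0..T})"
      and on: "orthonormal_L2 T N \<phi>" and m: "1 \<le> m" "m \<le> N" and n: "1 \<le> n"
    let ?min = "LEAST x. x \<in> (\<lambda>J. bracket_sqnorm T V (\<lambda>t. J t - J0 t)) ` fun_span m \<phi>"
    let ?risk = "\<integral>\<^sup>+\<omega>. ennreal (bracket_sqnorm T V
            (\<lambda>t. J_hat T V \<phi> (\<lambda>i. signal_process T V J0 (Mi i)) m N n \<omega> t - J0 t)) \<partial>Q"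
    show "?risk \<le> ennreal (2 * ?min) + ennreal c * (ennreal (real m / real N)
                        + of_nat m * R_sup T \<phi>' m / (of_nat n)\<^sup>2)"
    proof (cases "R_sup T \<phi>' m = \<infinity>")
      case True
      have "of_nat m * R_sup T \<phi>' m / (of_nat n)\<^sup>2 = (\<infinity> :: ennreal)"
        using True m(1) by (simp add: ennreal_mult_top ennreal_top_divide power_eq_top_ennreal)
      then show ?thesis using \<open>0 < c\<close> by (simp add: ennreal_mult_top)
    next
      case False
      define R where "R = enn2real (R_sup T \<phi>' m)"
      have R_eq: "R_sup T \<phi>' m = ennreal R" using False by (simp add: R_def less_top)
      have R0: "0 \<le> R" by (simp add: R_def)
      have R: "(\<Sum>j<m. (\<phi>' j t)\<^sup>2) \<le> R" if "t \<in> {0..T}" for t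
      proof -
        have "ennreal (\<Sum>j<m. (\<phi>' j t)\<^sup>2) \<le> R_sup T \<phi>' m"
          unfolding R_sup_def using that by (rule SUP_upper)
        then show ?thesis unfolding R_eq using R0 by simp
      qed
      have on_m: "orthonormal_L2 T m \<phi>" using on m(2) by (simp add: orthonormal_L2_def)
      have cont_m: "continuous_on {0..T} (\<phi> j)" if "j < m" for j using cont that m by simp
      have deriv_m: "(\<phi> j has_real_derivative \<phi>' j t) (at t within {0..T})"
        if "j < m" "t \<in> {0..T}" for j t using deriv that m by simp
      have pos: "0 < N" "0 < n" using N n by auto
      define \<eta> where "\<eta> = T\<^sup>2 * R / (1 / b * (real n)\<^sup>2)"
      have \<eta>0: "0 \<le> \<eta>" unfolding \<eta>_def using R0 b(1) by simp
      note noise = M.independent_copies_noise[OF Q ind pos(1),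
          where \<tau> = "\<lambda>l. real l * T / real n" and n = n,
          OF B.partition_step[OF pos(2)] B.partition_point[OF pos(2)]]
      have risk: "?risk \<le> ennreal ?min + ennreal (real m * (2 * \<eta> * K\<^sup>2))
          + ennreal (real m * (2 * ((2 + 2 * \<eta> * V T) / real N)))"
        unfolding \<eta>_def K_def
        by (rule B.risk_bound[OF Q J0 pos cont_m deriv_m on_m R noise])
      have arith: "real m * (2 * \<eta> * K\<^sup>2) + real m * (2 * ((2 + 2 * \<eta> * V T) / real N))
          \<le> c * (real m / real N + real m * R / (real n)\<^sup>2)"
      proof -
        \<comment> \<open>Generic variables hide the products from the linear arithmetic, which would normalise them differently.\<close>
        have combine: "p + q \<le> C" if "u \<le> w" "q = d + u" "e = p + w" "0 \<le> f" "0 \<le> h" "C = d + f + (h + e)"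
          for p q u w d e f h C :: real using that by linarith
        have "4 * \<eta> * V T / real N \<le> 4 * \<eta> * V T"
          using mult_nonneg_nonneg[OF \<eta>0 V0] N by (simp add: divide_le_eq mult_le_cancel_left1)
        then have "real m * (4 * \<eta> * V T / real N) \<le> real m * (4 * \<eta> * V T)"
          by (rule mult_left_mono) simp
        moreover have "real m * (2 * ((2 + 2 * \<eta> * V T) / real N))
           = 4 * (real m / real N) + real m * (4 * \<eta> * V T / real N)"
          by (simp add: add_divide_distrib algebra_simps)
        moreover have "(c - 4) * (real m * R / (real n)\<^sup>2) = real m * (2 * \<eta> * K\<^sup>2) + real m * (4 * \<eta> * V T)"
          unfolding c_def \<eta>_def by (simp add: add_divide_distrib algebra_simps)
        moreover have "0 \<le> (c - 4) * (real m / real N)" "0 \<le> 4 * (real m * R / (real n)\<^sup>2)"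
          unfolding c_def using V0 b(1) R0 by auto
        moreover have "c * (real m / real N + real m * R / (real n)\<^sup>2)
            = 4 * (real m / real N) + (c - 4) * (real m / real N)
              + (4 * (real m * R / (real n)\<^sup>2) + (c - 4) * (real m * R / (real n)\<^sup>2))"
          unfolding left_diff_distrib distrib_left by simp
        ultimately show ?thesis by (rule combine)
      qed
      have min_le: "ennreal ?min \<le> ennreal (2 * ?min)"
        by (cases "0 \<le> ?min") (auto intro!: ennreal_leI simp: ennreal_neg)
      have rest_le: "ennreal (real m * (2 * \<eta> * K\<^sup>2)) + ennreal (real m * (2 * ((2 + 2 * \<eta> * V T) / real N)))
          \<le> ennreal (c * (real m / real N + real m * R / (real n)\<^sup>2))"
      proof -
        have "0 \<le> real m * (2 * \<eta> * K\<^sup>2)" "0 \<le> real m * (2 * ((2 + 2 * \<eta> * V T) / real N))"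
          using \<eta>0 V0 by simp_all
        from ennreal_plus[OF this, symmetric] show ?thesis
          using ennreal_leI[OF arith] by (simp only:)
      qed
      have rhs: "ennreal (c * (real m / real N + real m * R / (real n)\<^sup>2))
          = ennreal c * (ennreal (real m / real N) + of_nat m * R_sup T \<phi>' m / (of_nat n)\<^sup>2)"
      proof -
        have "of_nat m * R_sup T \<phi>' m = ennreal (real m * R)"
          using R0 by (simp add: R_eq ennreal_of_nat_eq_real_of_nat ennreal_mult)
        moreover have "(of_nat n)\<^sup>2 = ennreal ((real n)\<^sup>2)"
          by (simp add: ennreal_of_nat_eq_real_of_nat ennreal_power)
        ultimately have "of_nat m * R_sup T \<phi>' m / (of_nat n)\<^sup>2 = ennreal (real m * R / (real n)\<^sup>2)"
          using R0 n by (simp only:) (rule divide_ennreal, auto)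
        then show ?thesis
          using \<open>0 < c\<close> R0 by (simp only:) (subst ennreal_plus[symmetric], simp, simp,
              rule ennreal_mult, simp_all)
      qed
      have "?risk \<le> ennreal ?min + (ennreal (real m * (2 * \<eta> * K\<^sup>2))
          + ennreal (real m * (2 * ((2 + 2 * \<eta> * V T) / real N))))"
        using risk by (simp only: add.assoc)
      also note add_mono[OF min_le rest_le]
      finally show ?thesis unfolding rhs .
    qed
  qed
qed

end
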